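(* Let $G$ be a finite group, $p$ a prime, and $S$ a Sylow $p$-subgroup of $G$. Every $G$-stable finite $S$-set splits uniquely, up to $S$-isomorphism, as a disjoint union of irreducible $G$-stable $S$-sets, and there is a one-to-one correspondence between the (isomorphism classes of) irreducible $G$-stable $S$-sets and the $G$-conjugacy classes of subgroups of $S$. Hence the semiring of isomorphism classes of $G$-stable finite $S$-sets is additively a free commutative monoid with rank equal to the number of $G$-conjugacy classes of subgroups in $S$.
   Context: For a finite $S$-set $X$, a subgroup $P\leq S$ and a homomorphism $\varphi\colon P\to S$, let ${}_{P,\varphi}X$ denote the set $X$ with the $P$-action $p.x:=\varphi(p)x$; in particular ${}_{P,\mathrm{incl}}X$ is the usual restriction of $X$ to $P$. A finite $S$-set $X$ is called $G$-stable if ${}_{P,\varphi}X$ is isomorphic to ${}_{P,\mathrm{incl}}X$ as $P$-sets for all $P\leq S$ and all homomorphisms $\varphi\colon P\to S$ induced by conjugation by an element of $G$ (i.e. $\varphi(x)=gxg^{-1}$ for some $g\in G$ with $gPg^{-1}\leq S$). The isomorphism classes of finite $S$-sets form a semiring $A_+(S)$ with disjoint union as addition and cartesian product as multiplication; the $G$-stable ones form a subsemiring. A $G$-stable $S$-set is irreducible if it is non-empty and is not isomorphic to a disjoint union of two non-empty $G$-stable $S$-sets. A $G$-conjugacy class of subgroups in $S$ is an equivalence class of subgroups $P\leq S$, where $P$ and $Q$ are equivalent if $Q=gPg^{-1}$ for some $g\in G$. *)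

theory Defs
  imports
    "HOL-Algebra.Group_Action"
    "HOL-Algebra.Ring"
    "HOL-Computational_Algebra.Primes"
begin

section \<open>Finite sets with a group action\<close>

record ('g, 'x) gset =
  points :: "'x set"
  act :: "'g \<Rightarrow> 'x \<Rightarrow> 'x"

definition finite_gset :: "('g, 'b) monoid_scheme \<Rightarrow> ('g, 'x) gset \<Rightarrow> bool" where
  "finite_gset H X \<longleftrightarrow> group_action H (points X) (act X) \<and> finite (points X)"

definition gset_iso ::
    "('g, 'b) monoid_scheme \<Rightarrow> ('g, 'x) gset \<Rightarrow> ('g, 'y) gset \<Rightarrow> bool" where
  "gset_iso H X Y \<longleftrightarrow>
    (\<exists>f. bij_betw f (points X) (points Y) \<and>
         (\<forall>h\<in>carrier H. \<forall>x\<in>points X. f (act X h x) = act Y h (f x)))"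

text \<open>
  In a \<^locale>\<open>group_action\<close>, group elements act by functions that are
  extensional on the carrier set; hence the uses of \<^const>\<open>restrict\<close> below.
\<close>

definition empty_gset :: "('g, 'x) gset" where
  "empty_gset = \<lparr>points = {}, act = (\<lambda>h. \<lambda>x\<in>{}. x)\<rparr>"

definition point_gset :: "'x \<Rightarrow> ('g, 'x) gset" where
  "point_gset a = \<lparr>points = {a}, act = (\<lambda>h. \<lambda>x\<in>{a}. x)\<rparr>"

definition gset_sum :: "('g, 'x) gset \<Rightarrow> ('g, 'y) gset \<Rightarrow> ('g, 'x + 'y) gset" where
  "gset_sum X Y =
    \<lparr>points = points X <+> points Y,
     act = (\<lambda>h. restrict (map_sum (act X h) (act Y h)) (points X <+> points Y))\<rparr>"

definition gset_prod :: "('g, 'x) gset \<Rightarrow> ('g, 'y) gset \<Rightarrow> ('g, 'x \<times> 'y) gset" where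
  "gset_prod X Y =
    \<lparr>points = points X \<times> points Y,
     act = (\<lambda>h. restrict (map_prod (act X h) (act Y h)) (points X \<times> points Y))\<rparr>"

definition gset_coprod :: "'i set \<Rightarrow> ('i \<Rightarrow> ('g, 'x) gset) \<Rightarrow> ('g, 'i \<times> 'x) gset" where
  "gset_coprod I Y =
    \<lparr>points = (SIGMA i:I. points (Y i)),
     act = (\<lambda>h. restrict (\<lambda>(i, x). (i, act (Y i) h x)) (SIGMA i:I. points (Y i)))\<rparr>"

text \<open>The set \<open>X\<close> on which \<open>p\<close> acts as \<open>\<phi> p\<close>; with the identity for \<open>\<phi>\<close> this
  is the restriction of the action to a subgroup.\<close>

definition gset_pullback :: "('g \<Rightarrow> 'g) \<Rightarrow> ('g, 'x) gset \<Rightarrow> ('g, 'x) gset" where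
  "gset_pullback \<phi> X = \<lparr>points = points X, act = (\<lambda>p. act X (\<phi> p))\<rparr>"


section \<open>The semiring of isomorphism classes\<close>

text \<open>
  Every finite set with an action is isomorphic to one whose points are natural
  numbers, so isomorphism classes are taken among those; the representative \<open>X\<close>
  itself may live on any type.
\<close>

definition gset_class ::
    "('g, 'b) monoid_scheme \<Rightarrow> ('g, 'x) gset \<Rightarrow> ('g, nat) gset set" where
  "gset_class H X = {Y. finite_gset H Y \<and> gset_iso H X Y}"

text \<open>The unions over representatives below are unions of a single class, because
  sum and product respect isomorphism.\<close>

definition burnside_semiring ::
    "('g, 'b) monoid_scheme \<Rightarrow> (('g, nat) gset set) ring" where
  "burnside_semiring H =
    \<lparr>carrier = gset_class H ` {X :: ('g, nat) gset. finite_gset H X},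
     monoid.mult = (\<lambda>a b. \<Union>X\<in>a. \<Union>Y\<in>b. gset_class H (gset_prod X Y)),
     one = gset_class H (point_gset (0 :: nat)),
     zero = gset_class H (empty_gset :: ('g, nat) gset),
     add = (\<lambda>a b. \<Union>X\<in>a. \<Union>Y\<in>b. gset_class H (gset_sum X Y))\<rparr>"


section \<open>Stable sets\<close>

definition sylow_subgroup :: "('g, 'b) monoid_scheme \<Rightarrow> nat \<Rightarrow> 'g set \<Rightarrow> bool" where
  "sylow_subgroup G p S \<longleftrightarrow>
    subgroup S G \<and> card S = p ^ multiplicity p (order G)"

definition conj_induced ::
    "('g, 'b) monoid_scheme \<Rightarrow> 'g set \<Rightarrow> 'g set \<Rightarrow> ('g \<Rightarrow> 'g) \<Rightarrow> bool" where
  "conj_induced G S P \<phi> \<longleftrightarrow>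
    \<phi> \<in> hom (G\<lparr>carrier := P\<rparr>) (G\<lparr>carrier := S\<rparr>) \<and>
    (\<exists>g\<in>carrier G. \<forall>x\<in>P. \<phi> x = g \<otimes>\<^bsub>G\<^esub> x \<otimes>\<^bsub>G\<^esub> inv\<^bsub>G\<^esub> g)"

definition stable_gset ::
    "('g, 'b) monoid_scheme \<Rightarrow> 'g set \<Rightarrow> ('g, 'x) gset \<Rightarrow> bool" where
  "stable_gset G S X \<longleftrightarrow>
    finite_gset (G\<lparr>carrier := S\<rparr>) X \<and>
    (\<forall>P \<phi>. subgroup P (G\<lparr>carrier := S\<rparr>) \<and> conj_induced G S P \<phi> \<longrightarrow>
       gset_iso (G\<lparr>carrier := P\<rparr>) (gset_pullback \<phi> X) (gset_pullback (\<lambda>x. x) X))"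

text \<open>Both summands of a set isomorphic to \<open>X\<close> embed into \<open>X\<close>, so it is no
  restriction that they are taken on the same type as \<open>X\<close>.\<close>

definition irreducible_stable_gset ::
    "('g, 'b) monoid_scheme \<Rightarrow> 'g set \<Rightarrow> ('g, 'x) gset \<Rightarrow> bool" where
  "irreducible_stable_gset G S X \<longleftrightarrow>
    stable_gset G S X \<and> points X \<noteq> {} \<and>
    \<not> (\<exists>(Y :: ('g, 'x) gset) (Z :: ('g, 'x) gset).
         stable_gset G S Y \<and> points Y \<noteq> {} \<and>
         stable_gset G S Z \<and> points Z \<noteq> {} \<and>
         gset_iso (G\<lparr>carrier := S\<rparr>) X (gset_sum Y Z))"

definition irreducible_splitting ::
    "('g, 'b) monoid_scheme \<Rightarrow> 'g set \<Rightarrow> ('g, 'x) gset \<Rightarrow> nat \<Rightarrow> (nat \<Rightarrow> ('g, 'x) gset) \<Rightarrow> bool"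
  where
  "irreducible_splitting G S X n Y \<longleftrightarrow>
    (\<forall>i<n. irreducible_stable_gset G S (Y i)) \<and>
    gset_iso (G\<lparr>carrier := S\<rparr>) X (gset_coprod {..<n} Y)"

definition stable_semiring ::
    "('g, 'b) monoid_scheme \<Rightarrow> 'g set \<Rightarrow> (('g, nat) gset set) ring" where
  "stable_semiring G S =
    (burnside_semiring (G\<lparr>carrier := S\<rparr>))
      \<lparr>carrier := gset_class (G\<lparr>carrier := S\<rparr>) ` {X :: ('g, nat) gset. stable_gset G S X}\<rparr>"

definition irreducible_classes ::
    "('g, 'b) monoid_scheme \<Rightarrow> 'g set \<Rightarrow> ('g, nat) gset set set" where
  "irreducible_classes G S =
    gset_class (G\<lparr>carrier := S\<rparr>) ` {X :: ('g, nat) gset. irreducible_stable_gset G S X}"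


section \<open>Conjugacy classes of subgroups\<close>

definition subgroup_conj_rel ::
    "('g, 'b) monoid_scheme \<Rightarrow> 'g set \<Rightarrow> ('g set \<times> 'g set) set" where
  "subgroup_conj_rel G S =
    {(P, Q). subgroup P (G\<lparr>carrier := S\<rparr>) \<and> subgroup Q (G\<lparr>carrier := S\<rparr>) \<and>
             (\<exists>g\<in>carrier G. Q = g <#\<^bsub>G\<^esub> P #>\<^bsub>G\<^esub> inv\<^bsub>G\<^esub> g)}"

definition subgroup_conj_classes ::
    "('g, 'b) monoid_scheme \<Rightarrow> 'g set \<Rightarrow> 'g set set set" where
  "subgroup_conj_classes G S =
    {P. subgroup P (G\<lparr>carrier := S\<rparr>)} // subgroup_conj_rel G S"


section \<open>Free commutative monoids\<close>

definition free_comm_monoid_basis :: "('m, 'b) monoid_scheme \<Rightarrow> 'm set \<Rightarrow> bool" where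
  "free_comm_monoid_basis M B \<longleftrightarrow>
    B \<subseteq> carrier M \<and>
    (\<forall>x\<in>carrier M. \<exists>!c :: 'm \<Rightarrow> nat.
       c \<in> extensional B \<and> finite {b\<in>B. c b \<noteq> 0} \<and>
       x = (\<Otimes>\<^bsub>M\<^esub>b\<in>{b\<in>B. c b \<noteq> 0}. b [^]\<^bsub>M\<^esub> c b))"

definition free_comm_monoid_of_rank :: "('m, 'b) monoid_scheme \<Rightarrow> nat \<Rightarrow> bool" where
  "free_comm_monoid_of_rank M n \<longleftrightarrow>
    comm_monoid M \<and> (\<exists>B. free_comm_monoid_basis M B \<and> finite B \<and> card B = n)"

end

theory Submission
  imports Defs "HOL-Algebra.Sylow"
begin

text \<open>
  The isomorphism type of a finite \<open>S\<close>-set is determined by its marks, the numbers of fixed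
  points of the subgroups \<open>P\<close> of \<open>S\<close>, and \<open>X\<close> is \<open>G\<close>-stable iff its mark is constant on
  \<open>G\<close>-conjugacy classes of subgroups. Choose in every such class a representative \<open>Q\<close> whose
  normalizer in \<open>S\<close> is a Sylow subgroup of its normalizer in \<open>G\<close>. Comparing marks from
  large subgroups to small ones shows that a stable set is determined by the numbers of its
  orbits of type \<open>S/Q\<close> for the representatives \<open>Q\<close>. Conversely every vector of natural
  numbers occurs: starting with the prescribed orbits of type \<open>S/Q\<close>, go down the subgroups
  \<open>P\<close> by size and add orbits of type \<open>S/P\<close>, with \<open>P\<close> not \<open>S\<close>-conjugate to a
  representative, until the mark at \<open>P\<close> equals the mark at the representative \<open>Q\<close> of its
  class; that the difference of the marks is nonnegative and divisible by the index of \<open>P\<close>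
  in its normalizer is where the choice of \<open>Q\<close> enters. So the stable sets form the monoid of
  all natural vectors indexed by the classes.
\<close>

section \<open>Finite group actions\<close>

text \<open>Two kinds of numbers are used side by side. Counts of points with stabilizer exactly
  \<open>R\<close> can be prescribed freely, subject only to invariance under conjugation and one
  divisibility. Marks are what stability constrains. Summation over overgroups turns counts into
  marks, and inversion leads back. The descent by order works because an orbit of type S/P changes
  marks only at subgroups contained in an \<open>S\<close>-conjugate of \<open>P\<close>: a
  correction at \<open>P\<close> disturbs neither larger subgroups nor the other
  \<open>S\<close>-classes of the same order. The representative of a class cannot be arbitrary. One
  copy of S/P adds |N(P)|/|P| to the mark at \<open>P\<close>, normalizers taken in
  \<open>S\<close>, while orbits of type S/Q add multiples of |N(Q)|/|Q| at \<open>Q\<close>. If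
  \<open>Q\<close> is \<open>G\<close>-conjugate to \<open>P\<close> and has the larger normalizer,
  a single copy of S/P cannot be balanced at \<open>Q\<close>. So orbit numbers must be prescribed
  at a subgroup whose normalizer is as large as possible.\<close>

definition conj_set :: "('g, 'b) monoid_scheme \<Rightarrow> 'g \<Rightarrow> 'g set \<Rightarrow> 'g set" where
  "conj_set G g P = (\<lambda>x. g \<otimes>\<^bsub>G\<^esub> x \<otimes>\<^bsub>G\<^esub> inv\<^bsub>G\<^esub> g) ` P"

definition set_normalizer :: "('g, 'b) monoid_scheme \<Rightarrow> 'g set \<Rightarrow> 'g set" where
  "set_normalizer G P = {g \<in> carrier G. conj_set G g P = P}"

definition stab_points ::
    "('g, 'b) monoid_scheme \<Rightarrow> 'x set \<Rightarrow> ('g \<Rightarrow> 'x \<Rightarrow> 'x) \<Rightarrow> 'g set \<Rightarrow> 'x set" where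
  "stab_points G E a R = {x \<in> E. stabilizer G a x = R}"

definition fixed_points :: "'x set \<Rightarrow> ('g \<Rightarrow> 'x \<Rightarrow> 'x) \<Rightarrow> 'g set \<Rightarrow> 'x set" where
  "fixed_points E a R = {x \<in> E. \<forall>r\<in>R. a r x = x}"

context group
begin

lemma conj_set_eq_coset: "g <# P #> inv g = conj_set G g P"
  by (auto simp: conj_set_def l_coset_def r_coset_def)

lemma inv_cancel_left [simp]:
  assumes "g \<in> carrier G" "x \<in> carrier G"
  shows "inv g \<otimes> (g \<otimes> x) = x" "g \<otimes> (inv g \<otimes> x) = x"
  using assms by (simp_all flip: m_assoc)

lemma conj_cancel [simp]:
  assumes "g \<in> carrier G" "x \<in> carrier G"
  shows "inv g \<otimes> (g \<otimes> x \<otimes> inv g) \<otimes> g = x" "g \<otimes> (inv g \<otimes> x \<otimes> g) \<otimes> inv g = x"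
  using assms by (simp_all add: m_assoc)

lemma conj_set_subset:
  "\<lbrakk>g \<in> carrier G; P \<subseteq> carrier G\<rbrakk> \<Longrightarrow> conj_set G g P \<subseteq> carrier G"
  by (auto simp: conj_set_def)

lemma conj_set_mult:
  assumes "g \<in> carrier G" "h \<in> carrier G" "P \<subseteq> carrier G"
  shows "conj_set G (g \<otimes> h) P = conj_set G g (conj_set G h P)"
  unfolding conj_set_def image_image
  using assms by (intro image_cong) (auto simp: inv_mult_group m_assoc subset_iff)

lemma conj_set_one [simp]: "P \<subseteq> carrier G \<Longrightarrow> conj_set G \<one> P = P"
  by (force simp: conj_set_def)

lemma conj_set_inv [simp]:
  assumes "g \<in> carrier G" "P \<subseteq> carrier G"
  shows "conj_set G (inv g) (conj_set G g P) = P" "conj_set G g (conj_set G (inv g) P) = P"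
  using assms by (simp_all flip: conj_set_mult)

lemma inj_on_conj: "\<lbrakk>g \<in> carrier G; P \<subseteq> carrier G\<rbrakk> \<Longrightarrow> inj_on (\<lambda>x. g \<otimes> x \<otimes> inv g) P"
  by (rule inj_on_inverseI[where g = "\<lambda>x. inv g \<otimes> x \<otimes> g"]) auto

lemma card_conj_set:
  "\<lbrakk>g \<in> carrier G; P \<subseteq> carrier G\<rbrakk> \<Longrightarrow> card (conj_set G g P) = card P"
  unfolding conj_set_def by (intro card_image inj_on_conj)

lemma conj_hom: "g \<in> carrier G \<Longrightarrow> (\<lambda>x. g \<otimes> x \<otimes> inv g) \<in> hom G G"
  by (auto intro!: homI simp: m_assoc)

lemma subgroup_conj_set:
  assumes "subgroup P G" "g \<in> carrier G"
  shows "subgroup (conj_set G g P) G"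
proof -
  interpret group_hom G G "\<lambda>x. g \<otimes> x \<otimes> inv g"
    using assms(2) by unfold_locales (rule conj_hom)
  show ?thesis
    unfolding conj_set_def by (rule subgroup_img_is_subgroup[OF assms(1)])
qed

lemma conj_set_self:
  assumes "subgroup P G" "g \<in> P"
  shows "conj_set G g P = P"
proof -
  interpret P: subgroup P G by fact
  have "conj_set G k P \<subseteq> P" if "k \<in> P" for k
    using that by (auto simp: conj_set_def)
  from this[of "inv g"] this[of g] show ?thesis
    using assms conj_set_inv(2)[of g P] P.subset image_mono[of "conj_set G (inv g) P" P]
    by (metis P.m_inv_closed conj_set_def subset_antisym subsetD)
qed

lemma subgroup_set_normalizer:
  assumes "P \<subseteq> carrier G"
  shows "subgroup (set_normalizer G P) G"
proof (rule subgroupI)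
  show "set_normalizer G P \<noteq> {}"
    using assms by (auto simp: set_normalizer_def intro!: exI[of _ \<one>])
  show "inv g \<in> set_normalizer G P" if "g \<in> set_normalizer G P" for g
    using that conj_set_inv(1)[OF _ assms, of g] by (simp add: set_normalizer_def)
qed (use assms in \<open>auto simp: set_normalizer_def conj_set_mult\<close>)

lemma subset_set_normalizer: "subgroup P G \<Longrightarrow> P \<subseteq> set_normalizer G P"
  by (auto simp: set_normalizer_def conj_set_self dest: subgroup.subset)

lemma conj_set_subgroup_eq:
  assumes "subgroup S G" "g \<in> S" "P \<subseteq> S"
  shows "conj_set (G\<lparr>carrier := S\<rparr>) g P = conj_set G g P"
  using assms(1,2) by (simp add: conj_set_def)

lemma set_normalizer_subgroup_eq:
  assumes "subgroup S G" "P \<subseteq> S"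
  shows "set_normalizer (G\<lparr>carrier := S\<rparr>) P = set_normalizer G P \<inter> S"
  using assms subgroup.subset[OF assms(1)]
  by (auto simp: set_normalizer_def conj_set_subgroup_eq[OF assms(1) _ assms(2)])

lemma subgroup_of_subgroup_iff:
  assumes "subgroup S G"
  shows "subgroup P (G\<lparr>carrier := S\<rparr>) \<longleftrightarrow> subgroup P G \<and> P \<subseteq> S"
  using incl_subgroup[OF assms, of P] subgroup_incl[OF _ assms, of P]
    subgroup.subset[of P "G\<lparr>carrier := S\<rparr>"] by auto

end

locale fin_group = group +
  assumes fin_G: "finite (carrier G)"
begin

lemma finite_subgroup: "subgroup P G \<Longrightarrow> finite P"
  using fin_G subgroup.subset finite_subset by blast

lemma finite_subgroups: "finite {R. subgroup R G}"
  by (rule finite_subset[of _ "Pow (carrier G)"]) (auto simp: fin_G dest: subgroup.subset)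

lemma fin_group_subgroup: "subgroup P G \<Longrightarrow> fin_group (G\<lparr>carrier := P\<rparr>)"
  by (simp add: fin_group_def fin_group_axioms_def subgroup.subgroup_is_group finite_subgroup group_axioms)

end

text \<open>Unlike in \<^locale>\<open>group_action\<close>, the maps need not be extensional, so that
  one and the same map acts on every invariant subset.\<close>

locale fin_action = fin_group G for G (structure) +
  fixes E :: "'x set" and a :: "'a \<Rightarrow> 'x \<Rightarrow> 'x"
  assumes fin_E: "finite E"
    and closed: "\<And>g x. \<lbrakk>g \<in> carrier G; x \<in> E\<rbrakk> \<Longrightarrow> a g x \<in> E"
    and act_one [simp]: "\<And>x. x \<in> E \<Longrightarrow> a \<one> x = x"
    and act_mult: "\<And>g h x. \<lbrakk>g \<in> carrier G; h \<in> carrier G; x \<in> E\<rbrakk> \<Longrightarrow> a (g \<otimes> h) x = a g (a h x)"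
begin

lemma act_inv [simp]:
  "\<lbrakk>g \<in> carrier G; x \<in> E\<rbrakk> \<Longrightarrow> a (inv g) (a g x) = x"
  "\<lbrakk>g \<in> carrier G; x \<in> E\<rbrakk> \<Longrightarrow> a g (a (inv g) x) = x"
  by (simp_all flip: act_mult)

lemma bij_act: "g \<in> carrier G \<Longrightarrow> bij_betw (a g) E E"
  by (rule bij_betwI[where g = "a (inv g)"]) (auto simp: closed)

lemma group_action: "group_action G E (\<lambda>g. restrict (a g) E)"
proof -
  have "restrict (a g) E \<in> Bij E" if "g \<in> carrier G" for g
    using bij_act[OF that] by (simp add: Bij_def cong: bij_betw_cong)
  moreover have "restrict (a (g \<otimes> h)) E = compose E (restrict (a g) E) (restrict (a h) E)"
    if "g \<in> carrier G" "h \<in> carrier G" for g h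
    using that by (auto simp: compose_def fun_eq_iff closed act_mult)
  ultimately show ?thesis
    unfolding group_action_def group_hom_def group_hom_axioms_def
    using group_BijGroup[of E] by (auto simp: group_axioms BijGroup_def hom_def)
qed

lemma stabilizer_restrict:
  "x \<in> E \<Longrightarrow> stabilizer G (\<lambda>g. restrict (a g) E) x = stabilizer G a x"
  by (auto simp: stabilizer_def)

lemma orbit_restrict:
  "x \<in> E \<Longrightarrow> orbit G (\<lambda>g. restrict (a g) E) x = orbit G a x"
  by (auto simp: orbit_def)

lemma subgroup_stabilizer: "x \<in> E \<Longrightarrow> subgroup (stabilizer G a x) G"
  using group_action.stabilizer_subgroup[OF group_action] by (simp add: stabilizer_restrict)

lemma orbit_stabilizer: "x \<in> E \<Longrightarrow> card (orbit G a x) * card (stabilizer G a x) = order G"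
  using group_action.orbit_stabilizer_theorem[OF group_action, of x]
  by (simp add: stabilizer_restrict orbit_restrict)

lemma orbit_subset: "x \<in> E \<Longrightarrow> orbit G a x \<subseteq> E"
  by (auto simp: orbit_def closed)

lemma orbit_self: "x \<in> E \<Longrightarrow> x \<in> orbit G a x"
  by (force simp: orbit_def)

text \<open>The orbits partition \<open>E\<close>. The factor \<open>m\<close> keeps
  orbit-stabilizer counting free of division: an index |N|/|R| enters as |N| dividing a multiple of
  |R|.\<close>

lemma dvd_card_if_dvd_orbits:
  assumes "\<And>x. x \<in> E \<Longrightarrow> d dvd card (orbit G a x) * m"
  shows "d dvd card E * m"
proof -
  let ?O = "orbits G E (\<lambda>g. restrict (a g) E)"
  have "card E = (\<Sum>B\<in>?O. card B)"
    using group_action.disjoint_sum[OF group_action fin_E, of "\<lambda>_. 1::nat"] by simp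
  moreover have "d dvd card B * m" if "B \<in> ?O" for B
    using that assms by (auto simp: orbits_def orbit_restrict)
  ultimately show ?thesis
    by (auto simp: sum_distrib_right intro: dvd_sum)
qed

lemma fin_action_subset:
  assumes "F \<subseteq> E" "\<And>g x. \<lbrakk>g \<in> carrier G; x \<in> F\<rbrakk> \<Longrightarrow> a g x \<in> F"
  shows "fin_action G F a"
  using assms fin_G finite_subset[OF assms(1) fin_E] act_mult
  by unfold_locales (auto simp: subset_iff)

lemma fin_action_hom:
  assumes "group K" "finite (carrier K)" "\<phi> \<in> hom K G"
  shows "fin_action K E (\<lambda>k. a (\<phi> k))"
proof -
  interpret K: group K by fact
  interpret \<phi>: group_hom K G \<phi> using assms by unfold_locales
  show ?thesis
    using assms fin_E by unfold_locales (auto simp: closed act_mult)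
qed

lemma fin_action_subgroup:
  assumes "subgroup P G"
  shows "fin_action (G\<lparr>carrier := P\<rparr>) E a"
  using assms subgroup.subset[OF assms]
  by (intro fin_action_hom[of _ "\<lambda>x. x"])
     (auto simp: hom_def subgroup.subgroup_is_group finite_subset fin_G)

lemma stabilizer_act:
  assumes "g \<in> carrier G" "x \<in> E"
  shows "stabilizer G a (a g x) = conj_set G g (stabilizer G a x)" (is "?L = ?R")
proof
  have *: "a (g \<otimes> h \<otimes> inv g) (a g x) = a g (a h x)" if "h \<in> carrier G" for h
  proof -
    have "a (g \<otimes> h \<otimes> inv g) (a g x) = a (g \<otimes> h) (a (inv g) (a g x))"
      using that assms by (intro act_mult) (auto simp: closed)
    then show ?thesis
      using that assms by (simp add: act_mult)
  qed
  show "?R \<subseteq> ?L"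
    using assms * by (auto simp: conj_set_def stabilizer_def)
  show "?L \<subseteq> ?R"
  proof
    fix k assume k: "k \<in> ?L"
    then have kG: "k \<in> carrier G" by (simp add: stabilizer_def)
    have eq: "k = g \<otimes> (inv g \<otimes> k \<otimes> g) \<otimes> inv g"
      using kG assms by simp
    have "a g (a (inv g \<otimes> k \<otimes> g) x) = a g x"
      using *[of "inv g \<otimes> k \<otimes> g"] k kG assms by (simp add: stabilizer_def)
    then have "a (inv g \<otimes> k \<otimes> g) x = x"
      using bij_act[OF assms(1)] assms kG
      by (auto simp: bij_betw_def closed dest!: inj_onD)
    then have "inv g \<otimes> k \<otimes> g \<in> stabilizer G a x"
      using kG assms by (simp add: stabilizer_def)
    then show "k \<in> ?R"
      unfolding conj_set_def by (subst eq) (rule imageI)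
  qed
qed

lemma card_stab_points_conj:
  assumes "g \<in> carrier G" "R \<subseteq> carrier G"
  shows "card (stab_points G E a (conj_set G g R)) = card (stab_points G E a R)"
proof (rule bij_betw_same_card[symmetric])
  show "bij_betw (a g) (stab_points G E a R) (stab_points G E a (conj_set G g R))"
    using assms
    by (intro bij_betwI[where g = "a (inv g)"])
       (auto simp: stab_points_def stabilizer_act closed)
qed

text \<open>The quotient of the normalizer by \<open>R\<close> acts freely on the points with
  stabilizer \<open>R\<close>, so each of its orbits there has |N|/|R| points.\<close>

lemma dvd_card_stab_points:
  assumes "subgroup R G"
  shows "card (set_normalizer G R) dvd card (stab_points G E a R) * card R"
proof -
  let ?N = "set_normalizer G R"
  have RG: "R \<subseteq> carrier G" using assms by (rule subgroup.subset)
  interpret N: fin_action "G\<lparr>carrier := ?N\<rparr>" E a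
    by (rule fin_action_subgroup[OF subgroup_set_normalizer[OF RG]])
  interpret F: fin_action "G\<lparr>carrier := ?N\<rparr>" "stab_points G E a R" a
    by (rule N.fin_action_subset)
       (auto simp: stab_points_def closed set_normalizer_def stabilizer_act)
  show ?thesis
  proof (rule F.dvd_card_if_dvd_orbits)
    fix x assume x: "x \<in> stab_points G E a R"
    then have "stabilizer (G\<lparr>carrier := ?N\<rparr>) a x = R"
      using subset_set_normalizer[OF assms]
      by (auto simp: stab_points_def stabilizer_def set_normalizer_def)
    then show "card ?N dvd card (orbit (G\<lparr>carrier := ?N\<rparr>) a x) * card R"
      using F.orbit_stabilizer[OF x] by (simp add: order_def)
  qed
qed

lemma fixed_points_eq:
  "R \<subseteq> carrier G \<Longrightarrow> fixed_points E a R = {x \<in> E. R \<subseteq> stabilizer G a x}"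
  by (auto simp: fixed_points_def stabilizer_def)

text \<open>A point is fixed by \<open>R\<close> iff its stabilizer contains \<open>R\<close>;
  sorting the fixed points by stabilizer gives the sum that inversion later undoes.\<close>

lemma card_fixed_points:
  assumes "R \<subseteq> carrier G"
  shows "card (fixed_points E a R) = (\<Sum>Q | subgroup Q G \<and> R \<subseteq> Q. card (stab_points G E a Q))"
proof -
  have "fixed_points E a R = (\<Union>Q\<in>{Q. subgroup Q G \<and> R \<subseteq> Q}. stab_points G E a Q)"
    using subgroup_stabilizer by (auto simp: fixed_points_eq[OF assms] stab_points_def)
  also have "card \<dots> = (\<Sum>Q | subgroup Q G \<and> R \<subseteq> Q. card (stab_points G E a Q))"
    by (rule card_UN_disjoint)
       (auto simp: stab_points_def fin_E intro: finite_subset[OF _ finite_subgroups])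
  finally show ?thesis .
qed

text \<open>A group of prime power order: the orbits without fixed points have size divisible by \<open>p\<close>.\<close>

lemma p_group_fixed_points:
  assumes "prime p" "order G = p ^ n"
  shows "p dvd card E \<longleftrightarrow> p dvd card (fixed_points E a (carrier G))"
proof -
  let ?F = "fixed_points E a (carrier G)"
  have inv: "a g x \<in> E - ?F" if gx: "g \<in> carrier G" "x \<in> E - ?F" for g x
  proof -
    have "x \<in> ?F" if *: "a g x \<in> ?F"
    proof -
      have "a (inv g) (a g x) = a g x"
        using * gx by (auto simp: fixed_points_def)
      then have "a g x = x" using gx by simp
      with * show ?thesis by simp
    qed
    then show ?thesis using gx closed by auto
  qed
  interpret F: fin_action G "E - ?F" a
    by (rule fin_action_subset) (use inv in auto)
  have "p dvd card (E - ?F) * 1"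
  proof (rule F.dvd_card_if_dvd_orbits)
    fix x assume x: "x \<in> E - ?F"
    have "card (orbit G a x) dvd p ^ n"
      using F.orbit_stabilizer[OF x] assms(2) by (metis dvd_triv_left)
    then obtain k where k: "card (orbit G a x) = p ^ k"
      using assms(1) divides_primepow_nat by blast
    have "k \<noteq> 0"
    proof
      assume "k = 0"
      then obtain y where "orbit G a x = {y}" using k by (auto simp: card_1_singleton_iff)
      then have "y = x" using F.orbit_self[OF x] by auto
      then have "a g x = x" if "g \<in> carrier G" for g
        using \<open>orbit G a x = {y}\<close> that by (auto simp: orbit_def)
      with x show False by (auto simp: fixed_points_def)
    qed
    then show "p dvd card (orbit G a x) * 1" using k by simp
  qed
  moreover have "card E = card (E - ?F) + card ?F"
    using card_Diff_subset[of ?F E] card_mono[of E ?F] fin_E finite_subset[of ?F E]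
    by (simp add: fixed_points_def)
  ultimately show ?thesis by (simp add: dvd_add_right_iff)
qed

end

text \<open>Induction from large sets to small: once \<open>f\<close> and \<open>g\<close> agree on
  all strictly larger members of \<open>U\<close>, equal sums force equality at \<open>R\<close>.
  Restricting to an upward closed \<open>V\<close> allows inversion when the sums are known to agree
  only strictly above a given subgroup.\<close>

lemma Moebius_up_closed:
  fixes f g :: "'a set \<Rightarrow> nat"
  assumes "finite U" "\<And>R. R \<in> U \<Longrightarrow> finite R"
    and up: "\<And>R Q. \<lbrakk>R \<in> V; Q \<in> U; R \<subseteq> Q\<rbrakk> \<Longrightarrow> Q \<in> V" and "V \<subseteq> U"
    and eq: "\<And>R. R \<in> V \<Longrightarrow> (\<Sum>Q | Q \<in> U \<and> R \<subseteq> Q. f Q) = (\<Sum>Q | Q \<in> U \<and> R \<subseteq> Q. g Q)"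
    and "R \<in> V"
  shows "f R = g R"
  using \<open>R \<in> V\<close>
proof (induction "card (\<Union>U) - card R" arbitrary: R rule: less_induct)
  case less
  let ?W = "{Q \<in> U. R \<subset> Q}"
  have RU: "R \<in> U" using less.prems assms(4) by auto
  then have split: "{Q. Q \<in> U \<and> R \<subseteq> Q} = insert R ?W" by auto
  have "f Q = g Q" if Q: "Q \<in> ?W" for Q
  proof (rule less.hyps)
    have "card R < card Q" using Q assms(2) by (auto intro!: psubset_card_mono)
    moreover have "card Q \<le> card (\<Union>U)"
      using Q assms(1,2) by (intro card_mono) auto
    ultimately show "card (\<Union>U) - card Q < card (\<Union>U) - card R" by simp
    show "Q \<in> V" using Q less.prems up by auto
  qed
  then have "sum f ?W = sum g ?W" by simp
  then show ?case using eq[OF less.prems] assms(1) unfolding split by simp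
qed

section \<open>Equivariant bijections from equal stabilizer counts\<close>

lemma (in fin_action) act_eq_iff:
  assumes "g \<in> carrier G" "h \<in> carrier G" "x \<in> E"
  shows "a g x = a h x \<longleftrightarrow> inv h \<otimes> g \<in> stabilizer G a x"
proof -
  have "a (inv h \<otimes> g) x = a (inv h) (a g x)"
    using assms by (simp add: act_mult)
  moreover have "a (inv h) (a g x) = x \<longleftrightarrow> a g x = a h x"
    using assms by (metis act_inv closed)
  ultimately show ?thesis
    using assms by (simp add: stabilizer_def)
qed

text \<open>Stated for bare sets and maps, unlike \<open>gset_iso\<close>, so that the same maps can
  be compared on an orbit and on its complement.\<close>

definition equivariant_bij ::
    "('g, 'b) monoid_scheme \<Rightarrow> 'x set \<Rightarrow> ('g \<Rightarrow> 'x \<Rightarrow> 'x) \<Rightarrow> 'y set \<Rightarrow> ('g \<Rightarrow> 'y \<Rightarrow> 'y) \<Rightarrow> ('x \<Rightarrow> 'y) \<Rightarrow> bool"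
  where
  "equivariant_bij G E a F b f \<longleftrightarrow>
    bij_betw f E F \<and> (\<forall>g\<in>carrier G. \<forall>x\<in>E. f (a g x) = b g (f x))"

lemma stab_points_equivariant_bij:
  assumes "fin_action G E a" "equivariant_bij G E a F b f"
  shows "card (stab_points G E a R) = card (stab_points G F b R)"
proof (rule bij_betw_same_card)
  interpret fin_action G E a by fact
  have bij: "bij_betw f E F" and eq: "\<And>g x. \<lbrakk>g \<in> carrier G; x \<in> E\<rbrakk> \<Longrightarrow> f (a g x) = b g (f x)"
    using assms(2) by (auto simp: equivariant_bij_def)
  have "b g (f x) = f x \<longleftrightarrow> a g x = x" if "g \<in> carrier G" "x \<in> E" for g x
    using bij_betw_imp_inj_on[OF bij] that closed by (auto simp flip: eq dest: inj_onD)
  then have "stabilizer G b (f x) = stabilizer G a x" if "x \<in> E" for x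
    using that by (auto simp: stabilizer_def)
  then show "bij_betw f (stab_points G E a R) (stab_points G F b R)"
    by (intro bij_betw_subset[OF bij]) (use bij in \<open>auto simp: stab_points_def bij_betw_def\<close>)
qed

text \<open>Both orbits are \<open>G\<close> modulo the common stabilizer. Two group elements agree
  at \<open>x\<close> iff they agree at \<open>y\<close>, so sending \<open>a g x\<close> to
  \<open>b g y\<close> is well defined and injective, whichever \<open>g\<close> the choice operator
  picks.\<close>

lemma orbits_equivariant_bij:
  assumes "fin_action G E a" "fin_action G F b" "x \<in> E" "y \<in> F"
    and stab: "stabilizer G a x = stabilizer G b y"
  shows "\<exists>f. equivariant_bij G (orbit G a x) a (orbit G b y) b f"
proof -
  interpret E: fin_action G E a by fact
  interpret F: fin_action G F b by fact
  have iff: "a g x = a h x \<longleftrightarrow> b g y = b h y" if "g \<in> carrier G" "h \<in> carrier G" for g h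
    using that assms by (simp add: E.act_eq_iff F.act_eq_iff)
  define f where "f z = b (SOME g. g \<in> carrier G \<and> a g x = z) y" for z
  have f: "f (a g x) = b g y" if g: "g \<in> carrier G" for g
  proof -
    have "(SOME h. h \<in> carrier G \<and> a h x = a g x) \<in> carrier G \<and>
          a (SOME h. h \<in> carrier G \<and> a h x = a g x) x = a g x"
      by (rule someI[of _ g]) (use g in auto)
    then show ?thesis unfolding f_def using iff g by blast
  qed
  have "bij_betw f (orbit G a x) (orbit G b y)"
    unfolding bij_betw_def
  proof
    show "inj_on f (orbit G a x)"
      by (auto simp: inj_on_def orbit_def f iff)
    show "f ` orbit G a x = orbit G b y"
      by (force simp: orbit_def f)
  qed
  moreover have "f (a g z) = b g (f z)" if gz: "g \<in> carrier G" "z \<in> orbit G a x" for g z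
  proof -
    obtain h where h: "h \<in> carrier G" "z = a h x" using gz by (auto simp: orbit_def)
    then have "f (a g z) = f (a (g \<otimes>\<^bsub>G\<^esub> h) x)" using gz assms by (simp add: E.act_mult)
    then show ?thesis using h gz assms by (simp add: f F.act_mult)
  qed
  ultimately show ?thesis by (auto simp: equivariant_bij_def)
qed

lemma (in fin_action) fin_action_orbit:
  assumes "x \<in> E"
  shows "fin_action G (orbit G a x) a" "fin_action G (E - orbit G a x) a"
proof -
  have *: "a g z \<in> orbit G a x" if z: "z \<in> orbit G a x" and g: "g \<in> carrier G" for g z
  proof -
    obtain h where "h \<in> carrier G" "z = a h x" using z by (auto simp: orbit_def)
    then show ?thesis
      using g assms by (auto simp: orbit_def act_mult intro!: exI[of _ "g \<otimes> h"])
  qed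
  then show "fin_action G (orbit G a x) a"
    by (intro fin_action_subset orbit_subset assms)
  have "z \<in> orbit G a x" if "a g z \<in> orbit G a x" "g \<in> carrier G" "z \<in> E" for g z
    using *[OF that(1), of "inv g"] that by simp
  then show "fin_action G (E - orbit G a x) a"
    by (intro fin_action_subset) (auto simp: closed)
qed

lemma stab_points_Diff:
  "stab_points G (E - F) a R = stab_points G E a R - stab_points G F a R"
  by (auto simp: stab_points_def)

lemma (in fin_action) finite_stab_points: "finite (stab_points G E a R)"
  using fin_E by (simp add: stab_points_def)

lemma stab_points_mono: "E \<subseteq> F \<Longrightarrow> stab_points G E a R \<subseteq> stab_points G F a R"
  by (auto simp: stab_points_def)

text \<open>Equal counts supply, for a point \<open>x\<close> of \<open>E\<close>, a point
  \<open>y\<close> of \<open>F\<close> with the same stabilizer. Their orbits correspond, and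
  removing both subtracts the same amount from all counts, so the rest follows by induction.\<close>

theorem equivariant_bij_if_stab_points:
  assumes "fin_action G E a" "fin_action G F b"
    and "\<And>R. subgroup R G \<Longrightarrow> card (stab_points G E a R) = card (stab_points G F b R)"
  shows "\<exists>f. equivariant_bij G E a F b f"
  using assms
proof (induction "card E" arbitrary: E F rule: less_induct)
  case less
  interpret E: fin_action G E a by fact
  interpret F: fin_action G F b by fact
  show ?case
  proof (cases "E = {}")
    case True
    have "F = {}"
    proof (rule ccontr)
      assume "F \<noteq> {}"
      then obtain y where y: "y \<in> F" by blast
      then have "y \<in> stab_points G F b (stabilizer G b y)" by (simp add: stab_points_def)
      moreover have "card (stab_points G F b (stabilizer G b y)) = 0"
        using less.prems(3)[OF F.subgroup_stabilizer[OF y]] True by (simp add: stab_points_def)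
      ultimately show False using F.finite_stab_points by auto
    qed
    with True show ?thesis by (auto simp: equivariant_bij_def bij_betw_def)
  next
    case False
    then obtain x where x: "x \<in> E" by blast
    let ?R = "stabilizer G a x"
    have "x \<in> stab_points G E a ?R" using x by (simp add: stab_points_def)
    then have "card (stab_points G F b ?R) \<noteq> 0"
      using less.prems(3)[OF E.subgroup_stabilizer[OF x]] E.finite_stab_points
      by (metis card_eq_0_iff empty_iff)
    then obtain y where y: "y \<in> F" "stabilizer G a x = stabilizer G b y"
      by (metis (mono_tags, lifting) card.empty ex_in_conv mem_Collect_eq stab_points_def)
    let ?O = "orbit G a x" and ?P = "orbit G b y"
    obtain f where f: "equivariant_bij G ?O a ?P b f"
      using orbits_equivariant_bij[OF less.prems(1,2) x y] by blast
    have "card (E - ?O) < card E"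
      using x E.orbit_self[OF x] E.fin_E by (intro psubset_card_mono) auto
    moreover have "card (stab_points G (E - ?O) a R) = card (stab_points G (F - ?P) b R)"
      if "subgroup R G" for R
    proof -
      have "card (stab_points G ?O a R) = card (stab_points G ?P b R)"
        using E.fin_action_orbit(1)[OF x] f by (rule stab_points_equivariant_bij)
      moreover have "stab_points G ?O a R \<subseteq> stab_points G E a R" "stab_points G ?P b R \<subseteq> stab_points G F b R"
        by (intro stab_points_mono E.orbit_subset F.orbit_subset x y)+
      ultimately show ?thesis
        using less.prems(3)[OF that] E.finite_stab_points F.finite_stab_points
        by (simp add: stab_points_Diff card_Diff_subset finite_subset)
    qed
    ultimately obtain f' where f': "equivariant_bij G (E - ?O) a (F - ?P) b f'"
      using less.hyps E.fin_action_orbit(2)[OF x] F.fin_action_orbit(2)[OF y(1)] by blast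
    let ?f = "\<lambda>z. if z \<in> ?O then f z else f' z"
    have "bij_betw ?f ?O ?P" "bij_betw ?f (E - ?O) (F - ?P)"
      using f f' bij_betw_cong[of ?O ?f f ?P] bij_betw_cong[of "E - ?O" ?f f' "F - ?P"]
      by (auto simp: equivariant_bij_def)
    then have "bij_betw ?f (?O \<union> (E - ?O)) (?P \<union> (F - ?P))"
      by (rule bij_betw_combine) auto
    then have "bij_betw ?f E F"
      using E.orbit_subset[OF x] F.orbit_subset[OF y(1)] by (simp add: Un_absorb1)
    moreover have "?f (a g z) = b g (?f z)" if gz: "g \<in> carrier G" "z \<in> E" for g z
      using f f' gz fin_action.closed[OF E.fin_action_orbit(1)[OF x], of g z]
        fin_action.closed[OF E.fin_action_orbit(2)[OF x], of g z]
      by (auto simp: equivariant_bij_def)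
    ultimately show ?thesis unfolding equivariant_bij_def by blast
  qed
qed


section \<open>Coset actions and Sylow subgroups\<close>

context fin_group
begin

definition left_cosets :: "'a set \<Rightarrow> 'a set set" where
  "left_cosets Q = (\<lambda>g. l_coset G g Q) ` carrier G"

lemma fin_action_left_cosets:
  assumes "subgroup Q G"
  shows "fin_action G (left_cosets Q) (l_coset G)"
proof unfold_locales
  have Q: "Q \<subseteq> carrier G" using assms by (rule subgroup.subset)
  show "finite (left_cosets Q)" using fin_G by (simp add: left_cosets_def)
  show "l_coset G g x \<in> left_cosets Q" if "g \<in> carrier G" "x \<in> left_cosets Q" for g x
    using that Q by (auto simp: left_cosets_def lcos_m_assoc)
  show "l_coset G \<one> x = x" if "x \<in> left_cosets Q" for x
    using that Q by (auto simp: left_cosets_def lcos_m_assoc)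
  show "l_coset G (g \<otimes> h) x = l_coset G g (l_coset G h x)"
    if "g \<in> carrier G" "h \<in> carrier G" "x \<in> left_cosets Q" for g h x
    using that Q by (auto simp: left_cosets_def lcos_m_assoc m_assoc)
qed

lemma self_in_left_cosets: "subgroup Q G \<Longrightarrow> Q \<in> left_cosets Q"
  unfolding left_cosets_def
  by (rule image_eqI[of _ _ \<one>]) (simp_all add: lcos_mult_one subgroup.subset)

lemma stabilizer_left_cosets_self:
  assumes "subgroup Q G"
  shows "stabilizer G (l_coset G) Q = Q"
proof -
  interpret Q: subgroup Q G by fact
  have "g \<in> Q" if "g \<in> carrier G" "l_coset G g Q = Q" for g
  proof -
    have "g \<otimes> \<one> \<in> l_coset G g Q" by (force simp: l_coset_def)
    with that show ?thesis by simp
  qed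
  moreover have "l_coset G g Q = Q" if "g \<in> Q" for g
    using that assms by (metis coset_join3 Q.subset subsetD)
  ultimately show ?thesis by (auto simp: stabilizer_def)
qed

lemma stabilizer_left_cosets:
  assumes "subgroup Q G" "g \<in> carrier G"
  shows "stabilizer G (l_coset G) (l_coset G g Q) = conj_set G g Q"
  using fin_action.stabilizer_act[OF fin_action_left_cosets[OF assms(1)] assms(2)
      self_in_left_cosets[OF assms(1)]] stabilizer_left_cosets_self[OF assms(1)]
  by simp

lemma card_left_cosets:
  assumes "subgroup Q G"
  shows "card (left_cosets Q) * card Q = order G"
proof -
  have "orbit G (l_coset G) Q = left_cosets Q"
    by (auto simp: orbit_def left_cosets_def)
  then show ?thesis
    using fin_action.orbit_stabilizer[OF fin_action_left_cosets[OF assms] self_in_left_cosets[OF assms]]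
    by (simp add: stabilizer_left_cosets_self[OF assms])
qed

lemma card_subgroup_dvd: "subgroup Q G \<Longrightarrow> card Q dvd order G"
  using card_left_cosets by (metis dvd_triv_right)

text \<open>The set on the right consists of the fixed points of \<open>P\<close> on \<open>G/Q\<close>.\<close>

lemma p_subgroup_fixed_left_cosets:
  assumes "prime p" "subgroup P G" "card P = p ^ n" "subgroup Q G"
  shows "p dvd card (left_cosets Q) \<longleftrightarrow>
         p dvd card {C \<in> left_cosets Q. \<exists>g\<in>carrier G. C = l_coset G g Q \<and> P \<subseteq> conj_set G g Q}"
proof -
  interpret L: fin_action G "left_cosets Q" "l_coset G"
    by (rule fin_action_left_cosets) fact
  interpret P: fin_action "G\<lparr>carrier := P\<rparr>" "left_cosets Q" "l_coset G"
    by (rule L.fin_action_subgroup) fact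
  have "fixed_points (left_cosets Q) (l_coset G) P
      = {C \<in> left_cosets Q. \<exists>g\<in>carrier G. C = l_coset G g Q \<and> P \<subseteq> conj_set G g Q}"
    using assms(4) stabilizer_left_cosets unfolding L.fixed_points_eq[OF subgroup.subset[OF assms(2)]]
    by (auto simp: left_cosets_def)
  then show ?thesis
    using P.p_group_fixed_points[OF assms(1), of n] assms(3) by (simp add: order_def)
qed

text \<open>A coset gT is fixed by \<open>P\<close> iff \<open>P\<close> lies in the conjugate of
  \<open>T\<close> by \<open>g\<close>. Without fixed cosets, \<open>p\<close> would divide the
  index of \<open>T\<close>.\<close>

lemma p_subgroup_subset_conj:
  assumes "prime p" "subgroup P G" "card P = p ^ n" "subgroup T G" "\<not> p dvd card (left_cosets T)"
  shows "\<exists>g\<in>carrier G. P \<subseteq> conj_set G g T"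
proof (rule ccontr)
  assume *: "\<not> ?thesis"
  then have "{C \<in> left_cosets T. \<exists>g\<in>carrier G. C = l_coset G g T \<and> P \<subseteq> conj_set G g T} = {}" by blast
  then show False
    using p_subgroup_fixed_left_cosets[OF assms(1-4)] assms(5) by (metis card.empty dvd_0_right)
qed

text \<open>Let \<open>Q\<close> act on its own cosets. The number of fixed cosets is divisible by
  \<open>p\<close> and the coset \<open>Q\<close> is among them, so there is another one, gQ. Then
  \<open>Q\<close> is contained in its conjugate by \<open>g\<close>, hence equal to it by size, and
  \<open>g\<close> is not in \<open>Q\<close>.\<close>

lemma p_group_normalizer_grows:
  assumes "prime p" "order G = p ^ n" "subgroup Q G" "Q \<noteq> carrier G"
  shows "\<exists>g\<in>set_normalizer G Q. g \<notin> Q"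
proof -
  let ?F = "{C \<in> left_cosets Q. \<exists>g\<in>carrier G. C = l_coset G g Q \<and> Q \<subseteq> conj_set G g Q}"
  have Q: "Q \<subseteq> carrier G" using assms(3) by (rule subgroup.subset)
  obtain k where k: "card Q = p ^ k"
    using card_subgroup_dvd[OF assms(3)] assms(1,2) divides_primepow_nat by metis
  have "card (left_cosets Q) dvd p ^ n"
    using card_left_cosets[OF assms(3)] assms(2) by (metis dvd_triv_left)
  then obtain j where j: "card (left_cosets Q) = p ^ j"
    using assms(1) divides_primepow_nat by blast
  have "j \<noteq> 0"
  proof
    assume "j = 0"
    then have "card Q = card (carrier G)"
      using card_left_cosets[OF assms(3)] j by (simp add: order_def)
    with Q assms(4) fin_G show False using card_subset_eq by blast
  qed
  then have "p dvd card ?F"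
    using p_subgroup_fixed_left_cosets[OF assms(1,3) k assms(3)] j by simp
  then have "?F \<noteq> {Q}" using assms(1) by (metis card_1_singleton_iff not_prime_unit One_nat_def)
  moreover have "Q \<in> ?F"
    using Q self_in_left_cosets[OF assms(3)] by (auto intro!: bexI[of _ \<one>] simp: lcos_mult_one)
  ultimately obtain C where "C \<in> ?F" "C \<noteq> Q" by blast
  then obtain g where g: "g \<in> carrier G" "l_coset G g Q \<noteq> Q" "Q \<subseteq> conj_set G g Q" by blast
  have "conj_set G g Q = Q"
    using card_subset_eq[OF _ g(3)] card_conj_set[OF g(1) Q] finite_subset[OF conj_set_subset[OF g(1) Q] fin_G]
    by simp
  moreover have "g \<notin> Q"
    using g(2) stabilizer_left_cosets_self[OF assms(3)] by (auto simp: stabilizer_def)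
  ultimately show ?thesis using g(1) by (auto simp: set_normalizer_def)
qed

end

lemma sylow_index:
  assumes "fin_group G" "prime p" "subgroup S G" "card S = p ^ multiplicity p (order G)"
  shows "\<not> p dvd card (fin_group.left_cosets G S)"
proof
  interpret fin_group G by fact
  assume "p dvd card (left_cosets S)"
  then have "p * card S dvd card (left_cosets S) * card S"
    by (intro mult_dvd_mono) auto
  then have "p * card S dvd order G"
    unfolding card_left_cosets[OF assms(3)] .
  then have "p ^ Suc (multiplicity p (order G)) dvd order G"
    unfolding assms(4) power_Suc .
  moreover have "order G \<noteq> 0" using fin_G by (auto simp: order_def)
  moreover have "\<not> is_unit p" using assms(2) not_prime_unit[of p] by fast
  ultimately show False
    using power_dvd_iff_le_multiplicity[of "order G" p "Suc (multiplicity p (order G))"] by simp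
qed

section \<open>Marks and the isomorphism type of a finite set with action\<close>

definition nstab :: "('g, 'b) monoid_scheme \<Rightarrow> ('g, 'x) gset \<Rightarrow> 'g set \<Rightarrow> nat" where
  "nstab G X R = card (stab_points G (points X) (act X) R)"

text \<open>No group is mentioned, only the elements required to fix a point. The same number can
  therefore be read in a group, in its subgroups and, after taking an image, in a pullback.\<close>

definition mark :: "('g, 'x) gset \<Rightarrow> 'g set \<Rightarrow> nat" where
  "mark X R = card (fixed_points (points X) (act X) R)"

lemma gset_iso_iff_equivariant_bij:
  "gset_iso G X Y \<longleftrightarrow> (\<exists>f. equivariant_bij G (points X) (act X) (points Y) (act Y) f)"
  by (simp add: gset_iso_def equivariant_bij_def)

context fin_group
begin

text \<open>A \<open>group_action\<close> maps into \<open>BijGroup\<close>, whose elements are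
  extensional. Splitting off that condition leaves exactly \<open>fin_action\<close>.\<close>

lemma finite_gset_iff:
  "finite_gset G X \<longleftrightarrow>
    fin_action G (points X) (act X) \<and> (\<forall>g\<in>carrier G. act X g \<in> extensional (points X))"
proof
  assume X: "finite_gset G X"
  then interpret group_action G "points X" "act X" by (simp add: finite_gset_def)
  have "act X g \<in> extensional (points X)" if "g \<in> carrier G" for g
    using bij_prop0[OF that] by (simp add: Bij_def)
  moreover have "fin_action G (points X) (act X)"
  proof unfold_locales
    show "finite (points X)" using X by (simp add: finite_gset_def)
    show "act X g x \<in> points X" if "g \<in> carrier G" "x \<in> points X" for g x
      using element_image that by blast
    show "act X \<one> x = x" if "x \<in> points X" for x
      using id_eq_one that by (metis restrict_apply')
    show "act X (g \<otimes> h) x = act X g (act X h x)"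
      if "g \<in> carrier G" "h \<in> carrier G" "x \<in> points X" for g h x
      using composition_rule that by blast
  qed
  ultimately show "fin_action G (points X) (act X) \<and> (\<forall>g\<in>carrier G. act X g \<in> extensional (points X))"
    by blast
next
  assume X: "fin_action G (points X) (act X) \<and> (\<forall>g\<in>carrier G. act X g \<in> extensional (points X))"
  then interpret fin_action G "points X" "act X" by blast
  have eq: "restrict (act X g) (points X) = act X g" if "g \<in> carrier G" for g
    using X that by (simp add: extensional_restrict)
  have "group_hom G (BijGroup (points X)) (act X)"
  proof -
    have *: "(\<lambda>g. restrict (act X g) (points X)) \<in> hom G (BijGroup (points X))"
      using group_action group_action.group_hom group_hom.homh by blast
    have "act X \<in> hom G (BijGroup (points X))"
    proof (rule homI)
      show "act X g \<in> carrier (BijGroup (points X))" if "g \<in> carrier G" for g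
        using * eq[OF that] that by (auto simp: hom_def Pi_iff)
      show "act X (g \<otimes> h) = act X g \<otimes>\<^bsub>BijGroup (points X)\<^esub> act X h"
        if "g \<in> carrier G" "h \<in> carrier G" for g h
        using hom_mult[OF * that] eq[of g] eq[of h] eq[of "g \<otimes> h"] that by simp
    qed
    then show ?thesis
      by (simp add: group_hom_def group_hom_axioms_def group_BijGroup group_axioms)
  qed
  then show "finite_gset G X"
    using fin_E by (simp add: finite_gset_def group_action_def)
qed

lemma fin_action_gset: "finite_gset G X \<Longrightarrow> fin_action G (points X) (act X)"
  by (simp add: finite_gset_iff)

lemma finite_points: "finite_gset G X \<Longrightarrow> finite (points X)"
  by (simp add: finite_gset_def)

lemma finite_gsetI:
  assumes "finite (points X)"
    and "\<And>g x. \<lbrakk>g \<in> carrier G; x \<in> points X\<rbrakk> \<Longrightarrow> act X g x \<in> points X"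
    and "\<And>x. x \<in> points X \<Longrightarrow> act X \<one> x = x"
    and "\<And>g h x. \<lbrakk>g \<in> carrier G; h \<in> carrier G; x \<in> points X\<rbrakk>
           \<Longrightarrow> act X (g \<otimes> h) x = act X g (act X h x)"
    and "\<And>g. g \<in> carrier G \<Longrightarrow> act X g \<in> extensional (points X)"
  shows "finite_gset G X"
  unfolding finite_gset_iff using assms by (auto intro!: fin_action.intro fin_action_axioms.intro fin_group_axioms)

lemma gset_act:
  assumes "finite_gset G X" "x \<in> points X"
  shows "g \<in> carrier G \<Longrightarrow> act X g x \<in> points X" "act X \<one> x = x"
    "\<lbrakk>g \<in> carrier G; h \<in> carrier G\<rbrakk> \<Longrightarrow> act X (g \<otimes> h) x = act X g (act X h x)"
  using fin_action.closed fin_action.act_one fin_action.act_mult fin_action_gset[OF assms(1)] assms(2)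
  by metis+

lemma nstab_iso:
  "\<lbrakk>finite_gset G X; gset_iso G X Y\<rbrakk> \<Longrightarrow> nstab G X R = nstab G Y R"
  unfolding nstab_def gset_iso_iff_equivariant_bij
  using stab_points_equivariant_bij fin_action_gset by blast

lemma mark_eq_sum_nstab:
  assumes "finite_gset G X" "R \<subseteq> carrier G"
  shows "mark X R = (\<Sum>Q | Q \<in> {Q. subgroup Q G} \<and> R \<subseteq> Q. nstab G X Q)"
  unfolding mark_def nstab_def
  using fin_action.card_fixed_points[OF fin_action_gset[OF assms(1)] assms(2)] by simp

lemma gset_iso_iff_nstab:
  assumes "finite_gset G X" "finite_gset G Y"
  shows "gset_iso G X Y \<longleftrightarrow> (\<forall>R. subgroup R G \<longrightarrow> nstab G X R = nstab G Y R)"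
  using nstab_iso[OF assms(1), of Y]
    equivariant_bij_if_stab_points[OF assms[THEN fin_action_gset]]
  unfolding gset_iso_iff_equivariant_bij nstab_def by blast

text \<open>Burnside's theorem on marks: marks are sums of stabilizer counts over overgroups, and
  these sums are inverted with \<open>V\<close> the set of all subgroups.\<close>

lemma gset_iso_iff_mark:
  assumes "finite_gset G X" "finite_gset G Y"
  shows "gset_iso G X Y \<longleftrightarrow> (\<forall>R. subgroup R G \<longrightarrow> mark X R = mark Y R)"
proof
  assume "gset_iso G X Y"
  then show "\<forall>R. subgroup R G \<longrightarrow> mark X R = mark Y R"
    using assms by (auto simp: mark_eq_sum_nstab gset_iso_iff_nstab subgroup.subset intro!: sum.cong)
next
  assume eq: "\<forall>R. subgroup R G \<longrightarrow> mark X R = mark Y R"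
  have "nstab G X R = nstab G Y R" if "subgroup R G" for R
  proof (rule Moebius_up_closed[where U = "{Q. subgroup Q G}" and V = "{Q. subgroup Q G}"])
    show "(\<Sum>Q | Q \<in> {Q. subgroup Q G} \<and> P \<subseteq> Q. nstab G X Q) =
          (\<Sum>Q | Q \<in> {Q. subgroup Q G} \<and> P \<subseteq> Q. nstab G Y Q)" if "P \<in> {Q. subgroup Q G}" for P
      using eq that assms mark_eq_sum_nstab[of X P] mark_eq_sum_nstab[of Y P]
      by (simp add: subgroup.subset)
  qed (use that finite_subgroups finite_subgroup in auto)
  then show "gset_iso G X Y" using assms by (simp add: gset_iso_iff_nstab)
qed

lemma gset_iso_sym: "\<lbrakk>finite_gset G X; finite_gset G Y; gset_iso G X Y\<rbrakk> \<Longrightarrow> gset_iso G Y X"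
  by (simp add: gset_iso_iff_nstab)

lemma gset_iso_trans:
  "\<lbrakk>finite_gset G X; finite_gset G Y; finite_gset G Z; gset_iso G X Y; gset_iso G Y Z\<rbrakk>
    \<Longrightarrow> gset_iso G X Z"
  by (simp add: gset_iso_iff_nstab)

lemma finite_gset_empty: "finite_gset G empty_gset"
  by (rule finite_gsetI) (auto simp: empty_gset_def)

lemma finite_gset_point: "finite_gset G (point_gset x)"
  by (rule finite_gsetI) (auto simp: point_gset_def)

lemma finite_gset_sum: "\<lbrakk>finite_gset G X; finite_gset G Y\<rbrakk> \<Longrightarrow> finite_gset G (gset_sum X Y)"
  by (rule finite_gsetI) (auto simp: gset_sum_def finite_points gset_act)

lemma finite_gset_prod: "\<lbrakk>finite_gset G X; finite_gset G Y\<rbrakk> \<Longrightarrow> finite_gset G (gset_prod X Y)"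
  by (rule finite_gsetI) (auto simp: gset_prod_def finite_points gset_act)

lemma finite_gset_coprod:
  "\<lbrakk>finite I; \<And>i. i \<in> I \<Longrightarrow> finite_gset G (Y i)\<rbrakk> \<Longrightarrow> finite_gset G (gset_coprod I Y)"
  by (rule finite_gsetI) (auto simp: gset_coprod_def finite_points gset_act)

end

section \<open>Marks and stabilizer counts of sums, products and coproducts\<close>

lemma mark_empty: "mark empty_gset R = 0"
  by (simp add: mark_def empty_gset_def fixed_points_def)

lemma mark_point: "mark (point_gset x) R = 1"
proof -
  have "fixed_points {x} (\<lambda>h. \<lambda>y\<in>{x}. y) R = {x}"
    by (auto simp: fixed_points_def)
  then show ?thesis by (simp add: mark_def point_gset_def)
qed

lemma mark_sum:
  assumes "finite (points X)" "finite (points Y)"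
  shows "mark (gset_sum X Y) R = mark X R + mark Y R"
proof -
  have "fixed_points (points (gset_sum X Y)) (act (gset_sum X Y)) R =
      fixed_points (points X) (act X) R <+> fixed_points (points Y) (act Y) R"
    by (auto simp: fixed_points_def gset_sum_def)
  then show ?thesis using assms by (simp add: mark_def card_Plus fixed_points_def)
qed

lemma mark_prod: "mark (gset_prod X Y) R = mark X R * mark Y R"
proof -
  have "fixed_points (points (gset_prod X Y)) (act (gset_prod X Y)) R =
      fixed_points (points X) (act X) R \<times> fixed_points (points Y) (act Y) R"
    by (auto simp: fixed_points_def gset_prod_def)
  then show ?thesis by (simp add: mark_def card_cartesian_product)
qed

lemma mark_coprod:
  assumes "finite I" "\<And>i. i \<in> I \<Longrightarrow> finite (points (Y i))"
  shows "mark (gset_coprod I Y) R = (\<Sum>i\<in>I. mark (Y i) R)"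
proof -
  have "fixed_points (points (gset_coprod I Y)) (act (gset_coprod I Y)) R =
      (SIGMA i:I. fixed_points (points (Y i)) (act (Y i)) R)"
    by (auto simp: fixed_points_def gset_coprod_def)
  then show ?thesis using assms by (simp add: mark_def fixed_points_def)
qed

lemma nstab_empty: "nstab G empty_gset R = 0"
  by (simp add: nstab_def empty_gset_def stab_points_def)

lemma nstab_sum:
  assumes "finite (points X)" "finite (points Y)"
  shows "nstab G (gset_sum X Y) R = nstab G X R + nstab G Y R"
proof -
  have "stabilizer G (act (gset_sum X Y)) (Inl x) = stabilizer G (act X) x" if "x \<in> points X" for x
    using that by (auto simp: gset_sum_def stabilizer_def)
  moreover have "stabilizer G (act (gset_sum X Y)) (Inr y) = stabilizer G (act Y) y"
    if "y \<in> points Y" for y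
    using that by (auto simp: gset_sum_def stabilizer_def)
  ultimately have "stab_points G (points (gset_sum X Y)) (act (gset_sum X Y)) R =
      stab_points G (points X) (act X) R <+> stab_points G (points Y) (act Y) R"
    by (auto simp: stab_points_def gset_sum_def)
  then show ?thesis using assms by (simp add: nstab_def card_Plus stab_points_def)
qed

lemma nstab_coprod:
  assumes "finite I" "\<And>i. i \<in> I \<Longrightarrow> finite (points (Y i))"
  shows "nstab G (gset_coprod I Y) R = (\<Sum>i\<in>I. nstab G (Y i) R)"
proof -
  have "stab_points G (points (gset_coprod I Y)) (act (gset_coprod I Y)) R =
      (SIGMA i:I. stab_points G (points (Y i)) (act (Y i)) R)"
    by (auto simp: stab_points_def gset_coprod_def stabilizer_def)
  then show ?thesis using assms by (simp add: nstab_def stab_points_def)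
qed

context fin_group
begin

section \<open>Transport of actions and isomorphism classes\<close>

lemma gset_transport:
  assumes X: "finite_gset G X" and f: "inj_on f (points X)"
  shows "\<exists>Y. finite_gset G Y \<and> points Y = f ` points X \<and> gset_iso G X Y"
proof -
  define Y where "Y = \<lparr>points = f ` points X,
    act = (\<lambda>g. \<lambda>y\<in>f ` points X. f (act X g (inv_into (points X) f y)))\<rparr>"
  have act: "act Y g (f x) = f (act X g x)" if "x \<in> points X" for g x
    using that f by (simp add: Y_def)
  have pts: "points Y = f ` points X" by (simp add: Y_def)
  have "finite_gset G Y"
  proof (rule finite_gsetI)
    show "finite (points Y)" using finite_points[OF X] pts by simp
    show "act Y g \<in> extensional (points Y)" for g by (simp add: Y_def)
  qed (use gset_act[OF X] act pts in auto)
  moreover have "gset_iso G X Y"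
    unfolding gset_iso_def using act pts f gset_act[OF X] by (auto simp: bij_betw_def)
  ultimately show ?thesis using pts by blast
qed

lemma gset_transport_nat:
  assumes "finite_gset G X"
  shows "\<exists>Y :: ('a, nat) gset. finite_gset G Y \<and> gset_iso G X Y"
proof -
  obtain f :: "_ \<Rightarrow> nat" where "inj_on f (points X)"
    using finite_imp_inj_to_nat_seg finite_points[OF assms] by metis
  then show ?thesis using gset_transport[OF assms] by blast
qed

text \<open>\<open>X\<close> and \<open>Y\<close> may have different point types and need not be
  members of their classes, so a copy of \<open>X\<close> on \<open>nat\<close> links the
  two.\<close>

lemma gset_class_eq_iff:
  assumes "finite_gset G X" "finite_gset G Y"
  shows "gset_class G X = gset_class G Y \<longleftrightarrow> gset_iso G X Y"
proof
  assume eq: "gset_class G X = gset_class G Y"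
  obtain Z :: "('a, nat) gset" where Z: "finite_gset G Z" "gset_iso G X Z"
    using gset_transport_nat[OF assms(1)] by blast
  then have "Z \<in> gset_class G X" by (simp add: gset_class_def)
  then have "gset_iso G Y Z" unfolding eq by (simp add: gset_class_def)
  then show "gset_iso G X Y" using Z assms gset_iso_sym gset_iso_trans by blast
next
  assume "gset_iso G X Y"
  then show "gset_class G X = gset_class G Y"
    using assms by (auto simp: gset_class_def gset_iso_iff_nstab)
qed

section \<open>Realizing prescribed numbers of points with given stabilizer\<close>

lemma nstab_conj_set:
  assumes "finite_gset G X" "g \<in> carrier G" "R \<subseteq> carrier G"
  shows "nstab G X (conj_set G g R) = nstab G X R"
  unfolding nstab_def using fin_action.card_stab_points_conj[OF fin_action_gset] assms by blast

lemma set_normalizer_dvd_nstab: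
  assumes "finite_gset G X" "subgroup R G"
  shows "card (set_normalizer G R) dvd nstab G X R * card R"
  unfolding nstab_def using fin_action.dvd_card_stab_points[OF fin_action_gset] assms by blast

definition coset_gset :: "'a set \<Rightarrow> ('a, 'a set) gset" where
  "coset_gset Q = \<lparr>points = left_cosets Q, act = (\<lambda>g. restrict (l_coset G g) (left_cosets Q))\<rparr>"

lemma finite_gset_coset:
  assumes "subgroup Q G"
  shows "finite_gset G (coset_gset Q)"
proof -
  interpret fin_action G "left_cosets Q" "l_coset G"
    by (rule fin_action_left_cosets) fact
  show ?thesis
    by (rule finite_gsetI) (auto simp: coset_gset_def fin_E closed act_mult)
qed

lemma nstab_coset_eq_0:
  assumes "subgroup Q G" "\<And>g. g \<in> carrier G \<Longrightarrow> conj_set G g Q \<noteq> R"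
  shows "nstab G (coset_gset Q) R = 0"
proof -
  have *: "stabilizer G (\<lambda>g. restrict (l_coset G g) (left_cosets Q)) C = stabilizer G (l_coset G) C"
    if "C \<in> left_cosets Q" for C
    using that by (auto simp: stabilizer_def)
  then have "stab_points G (points (coset_gset Q)) (act (coset_gset Q)) R = {}"
  proof -
    have "stabilizer G (l_coset G) C \<noteq> R" if "C \<in> left_cosets Q" for C
      using that assms stabilizer_left_cosets by (auto simp: left_cosets_def)
    then show ?thesis using * by (auto simp: stab_points_def coset_gset_def)
  qed
  then show ?thesis by (simp add: nstab_def)
qed

text \<open>The cosets with stabilizer \<open>Q\<close> are the gQ with \<open>g\<close> in the
  normalizer of \<open>Q\<close>. They form a single orbit of the normalizer, with stabilizer
  \<open>Q\<close> at the coset \<open>Q\<close>.\<close>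

lemma nstab_coset_self:
  assumes "subgroup Q G"
  shows "nstab G (coset_gset Q) Q * card Q = card (set_normalizer G Q)"
proof -
  let ?N = "set_normalizer G Q" and ?a = "act (coset_gset Q)"
  have Q: "Q \<subseteq> carrier G" using assms by (rule subgroup.subset)
  have N: "subgroup ?N G" by (rule subgroup_set_normalizer[OF Q])
  interpret fin_action G "left_cosets Q" ?a
    using fin_action_gset[OF finite_gset_coset[OF assms]] by (simp add: coset_gset_def)
  interpret N: fin_action "G\<lparr>carrier := ?N\<rparr>" "left_cosets Q" ?a
    by (rule fin_action_subgroup[OF N])
  have stab: "stabilizer G ?a C = stabilizer G (l_coset G) C" if "C \<in> left_cosets Q" for C
    using that by (auto simp: stabilizer_def coset_gset_def)
  have "stab_points G (points (coset_gset Q)) ?a Q = orbit (G\<lparr>carrier := ?N\<rparr>) ?a Q"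
    using self_in_left_cosets[OF assms] stabilizer_left_cosets[OF assms] stab
    by (auto simp: stab_points_def coset_gset_def orbit_def set_normalizer_def left_cosets_def)
  moreover have "stabilizer (G\<lparr>carrier := ?N\<rparr>) ?a Q = Q"
    using stab[OF self_in_left_cosets[OF assms]] stabilizer_left_cosets_self[OF assms]
      subset_set_normalizer[OF assms] Q
    by (auto simp: stabilizer_def set_normalizer_def)
  ultimately show ?thesis
    using N.orbit_stabilizer[OF self_in_left_cosets[OF assms]] by (simp add: nstab_def order_def)
qed

text \<open>Both hypotheses hold for the counts of every action; this is the converse. They say that
  \<open>f\<close> is a sum of the counts of coset spaces, and the induction peels off one coset
  space at a time.\<close>

theorem gset_with_nstab:
  assumes "\<And>g R. \<lbrakk>g \<in> carrier G; subgroup R G\<rbrakk> \<Longrightarrow> f (conj_set G g R) = f R"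
    and "\<And>R. subgroup R G \<Longrightarrow> card (set_normalizer G R) dvd f R * card R"
  shows "\<exists>X :: ('a, nat) gset. finite_gset G X \<and> (\<forall>R. subgroup R G \<longrightarrow> nstab G X R = f R)"
  using assms
proof (induction "\<Sum>R | subgroup R G. f R" arbitrary: f rule: less_induct)
  case less
  show ?case
  proof (cases "\<forall>R. subgroup R G \<longrightarrow> f R = 0")
    case True
    then show ?thesis using finite_gset_empty nstab_empty by metis
  next
    case False
    then obtain Q where Q: "subgroup Q G" "f Q \<noteq> 0" by blast
    then have QG: "Q \<subseteq> carrier G" by (simp add: subgroup.subset)
    have cQ: "card Q > 0"
      using Q(1) finite_subgroup subgroup.one_closed by (auto simp: card_gt_0_iff)
    let ?k = "nstab G (coset_gset Q)"
    have k: "finite_gset G (coset_gset Q)" by (rule finite_gset_coset[OF Q(1)])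
    \<comment> \<open>The divisibility hypothesis, read through \<open>nstab_coset_self\<close>: a
      nonzero \<open>f Q\<close> has room for at least one copy of the coset space of
      \<open>Q\<close>.\<close>
    have kQ: "?k Q * card Q dvd f Q * card Q"
      using less.prems(2)[OF Q(1)] nstab_coset_self[OF Q(1)] by simp
    have "?k Q \<noteq> 0"
    proof
      assume "?k Q = 0"
      then show False using kQ Q(2) cQ by simp
    qed
    have "?k Q \<le> f Q"
      using dvd_imp_le[OF kQ] Q(2) cQ by simp
    \<comment> \<open>On the conjugacy class of \<open>Q\<close> both sides are constant, so the
      bound at \<open>Q\<close> suffices; elsewhere the coset space counts zero.\<close>
    have le: "?k R \<le> f R" if "subgroup R G" for R
    proof (cases "\<exists>g\<in>carrier G. conj_set G g Q = R")
      case True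
      then show ?thesis
        using less.prems(1)[OF _ Q(1)] nstab_conj_set[OF k _ QG] \<open>?k Q \<le> f Q\<close> by auto
    next
      case False
      then show ?thesis using nstab_coset_eq_0[OF Q(1), of R] by auto
    qed
    have "(\<Sum>R | subgroup R G. f R - ?k R) < (\<Sum>R | subgroup R G. f R)"
      using Q le \<open>?k Q \<noteq> 0\<close> finite_subgroups
      by (intro sum_strict_mono_ex1) (auto intro!: exI[of _ Q])
    moreover have "f (conj_set G g R) - ?k (conj_set G g R) = f R - ?k R"
      if "g \<in> carrier G" "subgroup R G" for g R
      using that less.prems(1) nstab_conj_set[OF k] by (simp add: subgroup.subset)
    moreover have "card (set_normalizer G R) dvd (f R - ?k R) * card R" if "subgroup R G" for R
      using less.prems(2)[OF that] set_normalizer_dvd_nstab[OF k that]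
      by (simp add: diff_mult_distrib dvd_diff_nat)
    ultimately obtain X :: "('a, nat) gset"
      where X: "finite_gset G X" "\<And>R. subgroup R G \<Longrightarrow> nstab G X R = f R - ?k R"
      using less.hyps[of "\<lambda>R. f R - ?k R"] by blast
    let ?Z = "gset_sum X (coset_gset Q)"
    have Z: "finite_gset G ?Z" using X(1) k by (rule finite_gset_sum)
    obtain Y :: "('a, nat) gset" where Y: "finite_gset G Y" "gset_iso G ?Z Y"
      using gset_transport_nat[OF Z] by blast
    have "nstab G Y R = f R" if "subgroup R G" for R
      using nstab_iso[OF Z Y(2), of R] nstab_sum[of X "coset_gset Q" G R] X k le[OF that] that
      by (simp add: finite_points)
    with Y(1) show ?thesis by blast
  qed
qed

end

lemma (in fin_group) mark_conj_set:
  assumes "finite_gset G X" "g \<in> carrier G" "R \<subseteq> carrier G"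
  shows "mark X (conj_set G g R) = mark X R"
proof -
  interpret fin_action G "points X" "act X" by (rule fin_action_gset) fact
  \<comment> \<open>One inequality for all \<open>k\<close> is enough: at \<open>inv g\<close> and
    the conjugate of \<open>R\<close> it is the reverse inequality.\<close>
  have le: "mark X P \<le> mark X (conj_set G k P)" if k: "k \<in> carrier G" and P: "P \<subseteq> carrier G" for k P
    unfolding mark_def
  proof (rule card_inj_on_le)
    show "inj_on (act X k) (fixed_points (points X) (act X) P)"
      using bij_act[OF k] by (auto simp: bij_betw_def fixed_points_def intro: inj_on_subset)
    show "act X k ` fixed_points (points X) (act X) P \<subseteq> fixed_points (points X) (act X) (conj_set G k P)"
    proof
      fix y assume "y \<in> act X k ` fixed_points (points X) (act X) P"
      then obtain x where x: "x \<in> points X" "P \<subseteq> stabilizer G (act X) x" "y = act X k x"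
        using fixed_points_eq[OF P] by auto
      then have "conj_set G k P \<subseteq> stabilizer G (act X) y"
        unfolding x(3) stabilizer_act[OF k x(1)] conj_set_def by (intro image_mono)
      then show "y \<in> fixed_points (points X) (act X) (conj_set G k P)"
        using x(1,3) k closed fixed_points_eq[OF conj_set_subset[OF k P]] by simp
    qed
    show "finite (fixed_points (points X) (act X) (conj_set G k P))"
      using fin_E by (simp add: fixed_points_def)
  qed
  from le[OF assms(2,3)] le[OF inv_closed[OF assms(2)] conj_set_subset[OF assms(2,3)]]
  show ?thesis using assms by simp
qed

section \<open>Stable sets and their marks\<close>

locale fin_group_pair = fin_group + S: subgroup S G for S
begin

abbreviation H where "H \<equiv> G\<lparr>carrier := S\<rparr>"

sublocale H: fin_group H
  by (rule fin_group_subgroup) (rule S.subgroup_axioms)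

lemma subgroup_H_iff: "subgroup P H \<longleftrightarrow> subgroup P G \<and> P \<subseteq> S"
  by (rule subgroup_of_subgroup_iff) (rule S.subgroup_axioms)

lemma subgroup_H_subset: "subgroup P H \<Longrightarrow> P \<subseteq> carrier G"
  by (auto simp: subgroup_H_iff)

lemma conj_set_H: "\<lbrakk>s \<in> S; P \<subseteq> S\<rbrakk> \<Longrightarrow> conj_set H s P = conj_set G s P"
  by (rule conj_set_subgroup_eq) (rule S.subgroup_axioms)

lemma set_normalizer_H: "P \<subseteq> S \<Longrightarrow> set_normalizer H P = set_normalizer G P \<inter> S"
  by (rule set_normalizer_subgroup_eq) (rule S.subgroup_axioms)

lemma finite_gset_pullback:
  assumes "finite_gset H X" "subgroup P G" "\<phi> \<in> hom (G\<lparr>carrier := P\<rparr>) H"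
  shows "finite_gset (G\<lparr>carrier := P\<rparr>) (gset_pullback \<phi> X)"
proof -
  interpret P: fin_group "G\<lparr>carrier := P\<rparr>" by (rule fin_group_subgroup) fact
  interpret fin_action H "points X" "act X" using assms(1) by (rule H.fin_action_gset)
  have "fin_action (G\<lparr>carrier := P\<rparr>) (points X) (\<lambda>p. act X (\<phi> p))"
    by (rule fin_action_hom) (use assms P.group_axioms P.fin_G in auto)
  moreover have "\<forall>p\<in>P. \<phi> p \<in> S" using assms(3) by (auto simp: hom_def)
  ultimately show ?thesis
    using assms(1) by (simp add: P.finite_gset_iff H.finite_gset_iff gset_pullback_def)
qed

lemma mark_pullback: "mark (gset_pullback \<phi> X) R = mark X (\<phi> ` R)"
  by (simp add: mark_def gset_pullback_def fixed_points_def)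

text \<open>An isomorphism of pullbacks is used only through the mark at the whole of
  \<open>P\<close>. Conversely it requires equal marks at every subgroup \<open>R\<close> of
  \<open>P\<close>, and there the condition applies again because the image of \<open>R\<close> is
  its conjugate by the same \<open>g\<close>.\<close>

lemma stable_gset_iff_mark:
  "stable_gset G S X \<longleftrightarrow> finite_gset H X \<and>
    (\<forall>P. \<forall>g\<in>carrier G. subgroup P H \<longrightarrow> conj_set G g P \<subseteq> S \<longrightarrow> mark X (conj_set G g P) = mark X P)"
    (is "_ \<longleftrightarrow> _ \<and> ?M")
proof (intro iffI conjI allI ballI impI)
  assume X: "stable_gset G S X"
  then show "finite_gset H X" by (simp add: stable_gset_def)
  fix P g assume g: "g \<in> carrier G" and P: "subgroup P H" and sub: "conj_set G g P \<subseteq> S"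
  have PG: "subgroup P G" "P \<subseteq> S" using P by (auto simp: subgroup_H_iff)
  interpret P: fin_group "G\<lparr>carrier := P\<rparr>" by (rule fin_group_subgroup) fact
  let ?\<phi> = "\<lambda>x. g \<otimes> x \<otimes> inv g"
  have \<phi>: "?\<phi> \<in> hom (G\<lparr>carrier := P\<rparr>) H"
    using sub conj_hom[OF g] PG by (auto simp: hom_def conj_set_def subset_iff)
  have id: "(\<lambda>x. x) \<in> hom (G\<lparr>carrier := P\<rparr>) H"
    using PG by (auto simp: hom_def)
  have "conj_induced G S P ?\<phi>" using g \<phi> by (auto simp: conj_induced_def)
  then have "gset_iso (G\<lparr>carrier := P\<rparr>) (gset_pullback ?\<phi> X) (gset_pullback (\<lambda>x. x) X)"
    using X P by (simp add: stable_gset_def)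
  then have "mark (gset_pullback ?\<phi> X) P = mark (gset_pullback (\<lambda>x. x) X) P"
    using P.gset_iso_iff_mark[OF finite_gset_pullback[OF _ PG(1) \<phi>]
        finite_gset_pullback[OF _ PG(1) id]] \<open>finite_gset H X\<close> P.subgroup_self
    by auto
  then show "mark X (conj_set G g P) = mark X P"
    by (simp add: mark_pullback conj_set_def)
next
  assume X: "finite_gset H X \<and> ?M"
  show "stable_gset G S X"
    unfolding stable_gset_def
  proof (intro conjI allI impI)
    fix P \<phi> assume "subgroup P H \<and> conj_induced G S P \<phi>"
    then obtain g where P: "subgroup P H" and \<phi>: "\<phi> \<in> hom (G\<lparr>carrier := P\<rparr>) H"
      and g: "g \<in> carrier G" "\<And>x. x \<in> P \<Longrightarrow> \<phi> x = g \<otimes> x \<otimes> inv g"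
      by (auto simp: conj_induced_def)
    have PG: "subgroup P G" "P \<subseteq> S" using P by (auto simp: subgroup_H_iff)
    interpret P: fin_group "G\<lparr>carrier := P\<rparr>" by (rule fin_group_subgroup) fact
    have id: "(\<lambda>x. x) \<in> hom (G\<lparr>carrier := P\<rparr>) H"
      using PG by (auto simp: hom_def)
    have "mark (gset_pullback \<phi> X) R = mark (gset_pullback (\<lambda>x. x) X) R"
      if R: "subgroup R (G\<lparr>carrier := P\<rparr>)" for R
    proof -
      have R': "subgroup R G" "R \<subseteq> P" using R PG subgroup_of_subgroup_iff by auto
      then have "\<phi> ` R = conj_set G g R"
        unfolding conj_set_def using g(2) by (intro image_cong) auto
      moreover have "\<phi> ` R \<subseteq> S" using \<phi> R' by (auto simp: hom_def)
      ultimately show ?thesis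
        using X g(1) R' PG by (simp add: mark_pullback subgroup_H_iff)
    qed
    then show "gset_iso (G\<lparr>carrier := P\<rparr>) (gset_pullback \<phi> X) (gset_pullback (\<lambda>x. x) X)"
      using P.gset_iso_iff_mark[OF finite_gset_pullback[OF _ PG(1) \<phi>]
          finite_gset_pullback[OF _ PG(1) id]] X by blast
  qed (use X in simp)
qed

lemma stable_imp_finite: "stable_gset G S X \<Longrightarrow> finite_gset H X"
  by (simp add: stable_gset_def)

lemma stable_imp_finite_points: "stable_gset G S X \<Longrightarrow> finite (points X)"
  using stable_imp_finite H.finite_points by blast

section \<open>Closure properties of stable sets\<close>

lemma stable_empty: "stable_gset G S empty_gset"
  by (simp add: stable_gset_iff_mark H.finite_gset_empty mark_empty)

lemma stable_point: "stable_gset G S (point_gset x)"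
  by (simp add: stable_gset_iff_mark H.finite_gset_point mark_point)

lemma stable_sum: "\<lbrakk>stable_gset G S X; stable_gset G S Y\<rbrakk> \<Longrightarrow> stable_gset G S (gset_sum X Y)"
  by (simp add: stable_gset_iff_mark H.finite_gset_sum mark_sum H.finite_points)

lemma stable_prod: "\<lbrakk>stable_gset G S X; stable_gset G S Y\<rbrakk> \<Longrightarrow> stable_gset G S (gset_prod X Y)"
  by (simp add: stable_gset_iff_mark H.finite_gset_prod mark_prod)

lemma stable_coprod:
  "\<lbrakk>finite I; \<And>i. i \<in> I \<Longrightarrow> stable_gset G S (Y i)\<rbrakk> \<Longrightarrow> stable_gset G S (gset_coprod I Y)"
  by (simp add: stable_gset_iff_mark H.finite_gset_coprod mark_coprod H.finite_points)

lemma stable_iso: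
  assumes "stable_gset G S X" "finite_gset H Y" "gset_iso H X Y"
  shows "stable_gset G S Y"
proof -
  have "mark Y P = mark X P" if "subgroup P H" for P
    using assms that H.gset_iso_iff_mark stable_imp_finite by metis
  moreover have "subgroup (conj_set G g P) H"
    if "g \<in> carrier G" "subgroup P H" "conj_set G g P \<subseteq> S" for g P
    using that subgroup_conj_set by (simp add: subgroup_H_iff)
  ultimately show ?thesis
    using assms by (auto simp: stable_gset_iff_mark)
qed

section \<open>Conjugacy in \<open>G\<close> between subgroups of \<open>S\<close>\<close>

abbreviation rel where "rel \<equiv> subgroup_conj_rel G S"

lemma rel_iff:
  "(P, Q) \<in> rel \<longleftrightarrow> subgroup P H \<and> subgroup Q H \<and> (\<exists>g\<in>carrier G. Q = conj_set G g P)"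
  by (simp add: subgroup_conj_rel_def conj_set_eq_coset)

lemma equiv_rel: "equiv {P. subgroup P H} rel"
proof (rule equivI)
  show "refl_on {P. subgroup P H} rel"
    by (auto simp: refl_on_def rel_iff subgroup_H_subset intro!: bexI[of _ \<one>])
  show "sym rel"
  proof (rule symI)
    fix P Q assume PQ: "(P, Q) \<in> rel"
    then obtain g where g: "g \<in> carrier G" "Q = conj_set G g P" by (auto simp: rel_iff)
    then have "P = conj_set G (inv g) Q"
      using PQ by (simp add: rel_iff subgroup_H_subset)
    then show "(Q, P) \<in> rel" using PQ g(1) by (auto simp: rel_iff)
  qed
  show "trans rel"
  proof (rule transI)
    fix P Q R assume PQR: "(P, Q) \<in> rel" "(Q, R) \<in> rel"
    then obtain g h where g: "g \<in> carrier G" "Q = conj_set G g P"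
      and h: "h \<in> carrier G" "R = conj_set G h Q" by (auto simp: rel_iff)
    then have "R = conj_set G (h \<otimes> g) P"
      using PQR by (simp add: conj_set_mult rel_iff subgroup_H_subset)
    then show "(P, R) \<in> rel" using PQR g(1) h(1) by (auto simp: rel_iff)
  qed
qed (auto simp: rel_iff)

lemma rel_card: "(P, Q) \<in> rel \<Longrightarrow> card Q = card P"
  by (auto simp: rel_iff card_conj_set subgroup_H_subset)

lemma stable_gset_iff_rel:
  "stable_gset G S X \<longleftrightarrow> finite_gset H X \<and> (\<forall>P Q. (P, Q) \<in> rel \<longrightarrow> mark X Q = mark X P)"
proof -
  have "subgroup (conj_set G g P) H \<longleftrightarrow> conj_set G g P \<subseteq> S"
    if "subgroup P H" "g \<in> carrier G" for P g
    using that subgroup_conj_set by (auto simp: subgroup_H_iff)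
  then have "(\<forall>P Q. (P, Q) \<in> rel \<longrightarrow> mark X Q = mark X P) \<longleftrightarrow> (\<forall>P. \<forall>g\<in>carrier G.
      subgroup P H \<longrightarrow> conj_set G g P \<subseteq> S \<longrightarrow> mark X (conj_set G g P) = mark X P)"
    unfolding rel_iff by blast
  then show ?thesis unfolding stable_gset_iff_mark by simp
qed

end

locale sylow_pair = fin_group_pair +
  fixes p :: nat
  assumes prime_p: "prime p" and sylow: "sylow_subgroup G p S"
begin

section \<open>Subgroups with large normalizer in \<open>S\<close>\<close>

lemma card_S: "card S = p ^ multiplicity p (order G)"
  using sylow by (simp add: sylow_subgroup_def)

lemma subgroup_H_card:
  assumes "subgroup P H"
  shows "\<exists>n. card P = p ^ n"
proof -
  have "card P dvd p ^ multiplicity p (order G)"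
    using H.card_subgroup_dvd[OF assms] by (simp add: order_def card_S)
  then show ?thesis using prime_p divides_primepow_nat by blast
qed

text \<open>Equivalently, the normalizer of \<open>Q\<close> in \<open>S\<close> is a Sylow subgroup of its normalizer in \<open>G\<close>
  (\<open>Q\<close> is fully normalized); only the property used later is recorded here.\<close>

definition well_placed :: "'a set \<Rightarrow> bool" where
  "well_placed Q \<longleftrightarrow> (\<forall>P. (P, Q) \<in> rel \<longrightarrow>
     (\<exists>g\<in>carrier G. conj_set G g P = Q \<and> conj_set G g (set_normalizer H P) \<subseteq> S))"

text \<open>Take a Sylow subgroup \<open>T\<close> of the normalizer \<open>N\<close> of
  \<open>P0\<close> in \<open>G\<close> and conjugate it into \<open>S\<close> by \<open>h\<close>;
  the image of \<open>P0\<close> is \<open>Q\<close>. For any conjugate \<open>P\<close>, the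
  normalizer of \<open>P\<close> in \<open>S\<close> is carried into \<open>N\<close>, as a p-group
  it is moved into \<open>T\<close> by an element of \<open>N\<close>, and \<open>h\<close> takes it
  into \<open>S\<close>.\<close>

lemma ex_well_placed:
  assumes P0: "subgroup P0 H"
  shows "\<exists>Q. (P0, Q) \<in> rel \<and> well_placed Q"
proof -
  have P0G: "subgroup P0 G" "P0 \<subseteq> S" "P0 \<subseteq> carrier G"
    using P0 by (auto simp: subgroup_H_iff)
  define N where "N = set_normalizer G P0"
  have N: "subgroup N G" unfolding N_def by (rule subgroup_set_normalizer) fact
  interpret N: fin_group "G\<lparr>carrier := N\<rparr>" by (rule fin_group_subgroup) fact
  have subN: "subgroup P (G\<lparr>carrier := N\<rparr>) \<longleftrightarrow> subgroup P G \<and> P \<subseteq> N" for P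
    by (rule subgroup_of_subgroup_iff) fact
  obtain T where T: "subgroup T (G\<lparr>carrier := N\<rparr>)"
    "card T = p ^ multiplicity p (order (G\<lparr>carrier := N\<rparr>))"
  proof -
    have "order (G\<lparr>carrier := N\<rparr>) = p ^ multiplicity p (order (G\<lparr>carrier := N\<rparr>)) *
        (order (G\<lparr>carrier := N\<rparr>) div p ^ multiplicity p (order (G\<lparr>carrier := N\<rparr>)))"
      by (simp add: multiplicity_dvd)
    from sylow_thm[OF prime_p N.group_axioms this N.fin_G] that show thesis by blast
  qed
  have TG: "subgroup T G" "T \<subseteq> N" "T \<subseteq> carrier G"
    using T(1) subgroup.subset by (auto simp: subN)
  have inT: "\<exists>n\<in>N. P \<subseteq> conj_set G n T" if P: "subgroup P G" "P \<subseteq> N" "card P = p ^ k" for P k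
  proof -
    have "\<exists>n\<in>carrier (G\<lparr>carrier := N\<rparr>). P \<subseteq> conj_set (G\<lparr>carrier := N\<rparr>) n T"
      by (rule N.p_subgroup_subset_conj[OF prime_p _ P(3) T(1)
            sylow_index[OF N.fin_group_axioms prime_p T]]) (use P subN in auto)
    then show ?thesis using conj_set_subgroup_eq[OF N] TG by auto
  qed
  \<comment> \<open>\<open>P0\<close> is normal in \<open>N\<close>, so the conjugation that brings
    it into \<open>T\<close> fixes it. Without this inclusion \<open>Q\<close> need not lie in
    \<open>S\<close>.\<close>
  have "P0 \<subseteq> T"
  proof -
    obtain k where k: "card P0 = p ^ k" using subgroup_H_card[OF P0] by blast
    obtain n where n: "n \<in> N" "P0 \<subseteq> conj_set G n T"
      using inT[OF P0G(1) _ k] subset_set_normalizer[OF P0G(1)] by (auto simp: N_def)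
    then have nG: "n \<in> carrier G" "conj_set G n P0 = P0" by (auto simp: N_def set_normalizer_def)
    have "conj_set G (inv n) P0 \<subseteq> conj_set G (inv n) (conj_set G n T)"
      using n(2) unfolding conj_set_def by (rule image_mono)
    moreover have "conj_set G (inv n) P0 = P0"
      using conj_set_inv(1)[OF nG(1) P0G(3)] nG(2) by simp
    ultimately show ?thesis using nG(1) TG(3) by simp
  qed
  obtain k where k: "k \<in> carrier G" "T \<subseteq> conj_set G k S"
    using p_subgroup_subset_conj[OF prime_p TG(1) T(2) S.subgroup_axioms
        sylow_index[OF fin_group_axioms prime_p S.subgroup_axioms card_S]] by blast
  define h where "h = inv k"
  have h: "h \<in> carrier G" using k by (simp add: h_def)
  have hT: "conj_set G h T \<subseteq> S"
  proof -
    have "conj_set G h T \<subseteq> conj_set G h (conj_set G k S)"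
      using k(2) unfolding conj_set_def by (rule image_mono)
    then show ?thesis using k(1) S.subset by (simp add: h_def)
  qed
  define Q where "Q = conj_set G h P0"
  have "Q \<subseteq> S"
    using \<open>P0 \<subseteq> T\<close> hT unfolding Q_def conj_set_def by blast
  then have "subgroup Q H" "(P0, Q) \<in> rel"
    using P0 h subgroup_conj_set[OF P0G(1) h] by (auto simp: Q_def rel_iff subgroup_H_iff)
  moreover have "well_placed Q"
    unfolding well_placed_def
  proof (intro allI impI)
    fix P assume "(P, Q) \<in> rel"
    then have "(P, P0) \<in> rel"
      using \<open>(P0, Q) \<in> rel\<close> equiv_rel by (meson equivE symE transE)
    then obtain x where x: "x \<in> carrier G" "P0 = conj_set G x P" and P: "subgroup P H"
      by (auto simp: rel_iff)
    have PG: "P \<subseteq> S" "P \<subseteq> carrier G" using P by (auto simp: subgroup_H_iff)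
    define M where "M = set_normalizer H P"
    have M: "subgroup M H" unfolding M_def by (rule H.subgroup_set_normalizer) (simp add: PG)
    then have MG: "subgroup M G" "M \<subseteq> carrier G" by (auto simp: subgroup_H_iff)
    \<comment> \<open>Conjugation by \<open>x\<close> takes \<open>P\<close> to \<open>P0\<close>
      and hence elements normalizing \<open>P\<close> to elements normalizing
      \<open>P0\<close>.\<close>
    have xM: "conj_set G x M \<subseteq> N"
    proof
      fix y assume "y \<in> conj_set G x M"
      then obtain m where m: "m \<in> M" "y = x \<otimes> m \<otimes> inv x" by (auto simp: conj_set_def)
      then have mG: "m \<in> carrier G" "conj_set G m P = P"
        using PG(2) unfolding M_def set_normalizer_H[OF PG(1)] by (auto simp: set_normalizer_def)
      have "conj_set G y P0 = conj_set G (y \<otimes> x) P"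
        using m mG x PG by (simp add: conj_set_mult)
      also have "y \<otimes> x = x \<otimes> m" using m mG x by (simp add: m_assoc)
      also have "conj_set G (x \<otimes> m) P = P0"
        using mG x PG by (simp add: conj_set_mult)
      finally show "y \<in> N" using m mG x by (simp add: N_def set_normalizer_def)
    qed
    obtain j where j: "card M = p ^ j" using subgroup_H_card[OF M] by blast
    obtain y where y: "y \<in> N" "conj_set G x M \<subseteq> conj_set G y T"
      using inT[OF subgroup_conj_set[OF MG(1) x(1)] xM, of j] card_conj_set[OF x(1) MG(2)] j by auto
    then have yG: "y \<in> carrier G" "conj_set G y P0 = P0" by (auto simp: N_def set_normalizer_def)
    then have yP0: "conj_set G (inv y) P0 = P0"
      using conj_set_inv(1)[OF yG(1) P0G(3)] by simp
    \<comment> \<open>From right to left: \<open>x\<close> moves \<open>P\<close> to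
      \<open>P0\<close>, \<open>inv y\<close> moves the image of \<open>M\<close> into
      \<open>T\<close> while fixing \<open>P0\<close>, and \<open>h\<close> moves \<open>T\<close>
      into \<open>S\<close> and \<open>P0\<close> to \<open>Q\<close>.\<close>
    let ?g = "h \<otimes> (inv y \<otimes> x)"
    have "conj_set G ?g P = Q"
      using h x yG(1) PG P0G yP0 by (simp add: conj_set_mult Q_def conj_set_subset)
    moreover have "conj_set G ?g M \<subseteq> S"
    proof -
      have "conj_set G (inv y) (conj_set G x M) \<subseteq> conj_set G (inv y) (conj_set G y T)"
        using y(2) unfolding conj_set_def by (rule image_mono)
      then have "conj_set G (inv y \<otimes> x) M \<subseteq> T"
        using yG(1) TG(3) x(1) MG(2) by (simp add: conj_set_mult)
      then have "conj_set G h (conj_set G (inv y \<otimes> x) M) \<subseteq> conj_set G h T"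
        unfolding conj_set_def by (rule image_mono)
      then show ?thesis using hT h yG(1) x(1) MG(2) by (simp add: conj_set_mult conj_set_subset)
    qed
    ultimately show "\<exists>g\<in>carrier G. conj_set G g P = Q \<and> conj_set G g (set_normalizer H P) \<subseteq> S"
      using h x(1) yG(1) unfolding M_def by blast
  qed
  ultimately show ?thesis by blast
qed

text \<open>The points fixed by \<open>P\<close>, and those fixed by \<open>Q = gPg\<inverse>\<close>, are acted on by the normalizer
  of \<open>P\<close> in \<open>S\<close>, in the latter case after conjugation by \<open>g\<close>. Marks of larger subgroups
  determine the number of points with stabilizer larger than \<open>P\<close>, so the difference
  comes from free orbits of the quotient of the normalizer by \<open>P\<close>; on the side of
  \<open>P\<close> there are none.\<close>

lemma mark_diff_dvd:
  assumes X: "finite_gset H X" and P: "subgroup P H" and g: "g \<in> carrier G"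
    and norm: "conj_set G g (set_normalizer H P) \<subseteq> S"
    and larger: "\<And>R Q. \<lbrakk>(R, Q) \<in> rel; card P < card R\<rbrakk> \<Longrightarrow> mark X R = mark X Q"
    and none: "nstab H X P = 0"
  shows "mark X P \<le> mark X (conj_set G g P)"
    and "card (set_normalizer H P) dvd (mark X (conj_set G g P) - mark X P) * card P"
proof -
  define N where "N = set_normalizer H P"
  have PS: "P \<subseteq> S" "subgroup P G" using P by (auto simp: subgroup_H_iff)
  have N: "subgroup N H" unfolding N_def by (rule H.subgroup_set_normalizer) (simp add: PS)
  then have NG: "subgroup N G" "N \<subseteq> S" by (auto simp: subgroup_H_iff)
  have PN: "P \<subseteq> N" unfolding N_def by (rule H.subset_set_normalizer) fact
  let ?K = "G\<lparr>carrier := N\<rparr>"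
  interpret K: fin_group ?K by (rule fin_group_subgroup) fact
  let ?E = "points X" and ?a = "act X" and ?b = "\<lambda>n. act X (g \<otimes> n \<otimes> inv g)"
  interpret E: fin_action H ?E ?a by (rule H.fin_action_gset[OF X])
  interpret A: fin_action ?K ?E ?a
    using E.fin_action_subgroup[OF N] by simp
  \<comment> \<open>The twisted action exists only because \<open>norm\<close> keeps the conjugated
    normalizer inside \<open>S\<close>.\<close>
  interpret B: fin_action ?K ?E ?b
  proof (rule E.fin_action_hom)
    show "(\<lambda>n. g \<otimes> n \<otimes> inv g) \<in> hom ?K H"
      using norm conj_hom[OF g] NG by (auto simp: hom_def conj_set_def N_def subset_iff)
  qed (simp_all add: K.group_axioms finite_subgroup[OF NG(1)])
  have subK: "subgroup R ?K \<longleftrightarrow> subgroup R G \<and> R \<subseteq> N" for R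
    by (rule subgroup_of_subgroup_iff) fact
  have PK: "subgroup P ?K" using PS PN subK by simp
  \<comment> \<open>At a subgroup strictly above \<open>P\<close> the sums for the two actions are
    marks at \<open>R\<close> and at its conjugate, which agree by \<open>larger\<close>. At
    \<open>P\<close> itself they may differ, so \<open>P\<close> is left out of
    \<open>?V\<close>.\<close>
  let ?U = "{R. subgroup R ?K}" and ?V = "{R. subgroup R ?K \<and> P \<subset> R}"
  let ?sa = "\<lambda>R. card (stab_points ?K ?E ?a R)" and ?sb = "\<lambda>R. card (stab_points ?K ?E ?b R)"
  have fa: "mark X R = (\<Sum>Q | Q \<in> ?U \<and> R \<subseteq> Q. ?sa Q)" if "R \<subseteq> N" for R
    using A.card_fixed_points[of R] that by (simp add: mark_def)
  have fb: "mark X (conj_set G g R) = (\<Sum>Q | Q \<in> ?U \<and> R \<subseteq> Q. ?sb Q)" if "R \<subseteq> N" for R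
  proof -
    have "fixed_points ?E ?b R = fixed_points ?E ?a (conj_set G g R)"
      by (simp add: fixed_points_def conj_set_def)
    then show ?thesis using B.card_fixed_points[of R] that by (simp add: mark_def)
  qed
  have eqV: "?sa R = ?sb R" if "R \<in> ?V" for R
  proof (rule Moebius_up_closed[where U = ?U and V = ?V])
    show "finite ?U" by (rule K.finite_subgroups)
    show "finite R" if "R \<in> ?U" for R using that K.finite_subgroup by blast
    show "R \<in> ?V" by fact
    fix R assume R: "R \<in> ?V"
    then have RG: "subgroup R G" "R \<subseteq> N" "P \<subset> R" using subK by auto
    have "conj_set G g R \<subseteq> S" using norm RG unfolding conj_set_def N_def by blast
    then have "(R, conj_set G g R) \<in> rel"
      using RG NG g subgroup_conj_set[OF RG(1) g] by (auto simp: rel_iff subgroup_H_iff)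
    moreover have "card P < card R"
      using RG finite_subgroup by (intro psubset_card_mono) auto
    ultimately have "mark X R = mark X (conj_set G g R)" by (rule larger)
    then show "(\<Sum>Q | Q \<in> ?U \<and> R \<subseteq> Q. ?sa Q) = (\<Sum>Q | Q \<in> ?U \<and> R \<subseteq> Q. ?sb Q)"
      using fa[OF RG(2)] fb[OF RG(2)] by simp
  qed auto
  have split: "{Q. Q \<in> ?U \<and> P \<subseteq> Q} = insert P ?V" using PK by auto
  have finV: "finite ?V" by (rule finite_subset[OF _ K.finite_subgroups]) auto
  have mP: "mark X P = ?sa P + sum ?sa ?V" and mQ: "mark X (conj_set G g P) = ?sb P + sum ?sb ?V"
    using fa[OF PN] fb[OF PN] finV unfolding split by simp_all
  moreover have "sum ?sa ?V = sum ?sb ?V" using eqV by (rule sum.cong[OF refl])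
  \<comment> \<open>The hypothesis \<open>none\<close> concerns stabilizers in \<open>S\<close>, not
    in \<open>N\<close>. If \<open>P\<close> is the stabilizer in \<open>N\<close>, the stabilizer
    \<open>T\<close> in \<open>S\<close> meets \<open>N\<close> in \<open>P\<close>, so
    \<open>P\<close> is its own normalizer in the p-group \<open>T\<close>; since normalizers grow,
    \<open>T\<close> equals \<open>P\<close>.\<close>
  moreover have "stab_points ?K ?E ?a P = {}"
  proof (rule ccontr)
    assume "stab_points ?K ?E ?a P \<noteq> {}"
    then obtain x where x: "x \<in> ?E" "stabilizer ?K ?a x = P" by (auto simp: stab_points_def)
    define T where "T = stabilizer H ?a x"
    have T: "subgroup T H" unfolding T_def by (rule E.subgroup_stabilizer) fact
    have TG: "subgroup T G" "T \<subseteq> S" using T by (auto simp: subgroup_H_iff)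
    have PT: "P = T \<inter> N" using x(2) NG by (auto simp: T_def stabilizer_def)
    have "T = P"
    proof (rule ccontr)
      assume "T \<noteq> P"
      interpret T: fin_group "G\<lparr>carrier := T\<rparr>" by (rule fin_group_subgroup) fact
      obtain n where n: "order (G\<lparr>carrier := T\<rparr>) = p ^ n"
        using subgroup_H_card[OF T] by (auto simp: order_def)
      have "subgroup P (G\<lparr>carrier := T\<rparr>)"
        using PS PT subgroup_of_subgroup_iff[OF TG(1)] by blast
      then obtain t where "t \<in> set_normalizer (G\<lparr>carrier := T\<rparr>) P" "t \<notin> P"
        using T.p_group_normalizer_grows[OF prime_p n] \<open>T \<noteq> P\<close> by auto
      moreover have "P \<subseteq> T" using PT by blast
      ultimately have t: "t \<in> T" "t \<in> set_normalizer G P" "t \<notin> P"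
        using set_normalizer_subgroup_eq[OF TG(1)] by auto
      then have "t \<in> N" unfolding N_def set_normalizer_H[OF PS(1)] using TG(2) by blast
      with t PT show False by blast
    qed
    then have "x \<in> stab_points H ?E ?a P" using x by (simp add: stab_points_def T_def)
    then show False using none E.finite_stab_points by (auto simp: nstab_def)
  qed
  ultimately have diff: "mark X (conj_set G g P) = mark X P + ?sb P" by simp
  then show "mark X P \<le> mark X (conj_set G g P)" by simp
  \<comment> \<open>As \<open>P\<close> is normal in \<open>N\<close>, the general divisibility for
    points with stabilizer \<open>P\<close> holds with all of \<open>N\<close>.\<close>
  have "set_normalizer ?K P = N"
    using set_normalizer_subgroup_eq[OF NG(1) PN] NG PS by (auto simp: N_def set_normalizer_H)
  then show "card (set_normalizer H P) dvd (mark X (conj_set G g P) - mark X P) * card P"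
    using B.dvd_card_stab_points[OF PK] diff by (simp add: N_def)
qed

end

section \<open>Stable sets are classified by orbit numbers at well placed subgroups\<close>

context sylow_pair
begin

text \<open>The choice depends on \<open>P\<close> only through its class, which makes
  \<open>rep\<close> constant on classes.\<close>

definition rep :: "'a set \<Rightarrow> 'a set" where
  "rep P = (SOME Q. Q \<in> rel `` {P} \<and> well_placed Q)"

definition reps :: "'a set set" where
  "reps = rep ` {P. subgroup P H}"

lemma rep:
  assumes "subgroup P H"
  shows "(P, rep P) \<in> rel" "well_placed (rep P)"
proof -
  have "\<exists>Q. Q \<in> rel `` {P} \<and> well_placed Q" using ex_well_placed[OF assms] by blast
  from someI_ex[OF this] show "(P, rep P) \<in> rel" "well_placed (rep P)"
    unfolding rep_def by auto
qed

lemma rep_eq_iff: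
  assumes "subgroup P H" "subgroup Q H"
  shows "rep P = rep Q \<longleftrightarrow> (P, Q) \<in> rel"
proof
  assume "rep P = rep Q"
  then have "(P, rep P) \<in> rel" "(Q, rep P) \<in> rel"
    using rep(1) assms by metis+
  then show "(P, Q) \<in> rel" using equiv_rel by (meson equivE symE transE)
next
  assume "(P, Q) \<in> rel"
  then have "rel `` {P} = rel `` {Q}" using equiv_class_eq[OF equiv_rel] by blast
  then show "rep P = rep Q" by (simp add: rep_def)
qed

lemma subgroup_rep: "subgroup P H \<Longrightarrow> subgroup (rep P) H"
  using rep(1) by (auto simp: rel_iff)

lemma subgroup_reps: "Q \<in> reps \<Longrightarrow> subgroup Q H"
  by (auto simp: reps_def subgroup_rep)

lemma rep_in_reps: "subgroup P H \<Longrightarrow> rep P \<in> reps"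
  by (simp add: reps_def)

lemma rep_reps [simp]: "Q \<in> reps \<Longrightarrow> rep Q = Q"
proof -
  assume "Q \<in> reps"
  then obtain P where P: "subgroup P H" "Q = rep P" by (auto simp: reps_def)
  then have "rep (rep P) = rep P"
    using rep_eq_iff[OF P(1) subgroup_rep[OF P(1)]] rep(1) by simp
  with P(2) show "rep Q = Q" by simp
qed

lemma finite_reps: "finite reps"
  unfolding reps_def by (intro finite_imageI H.finite_subgroups)

lemma bij_reps_classes: "bij_betw (\<lambda>Q. rel `` {Q}) reps (subgroup_conj_classes G S)"
  unfolding bij_betw_def
proof
  show "inj_on (\<lambda>Q. rel `` {Q}) reps"
  proof (rule inj_onI)
    fix P Q assume PQ: "P \<in> reps" "Q \<in> reps" "rel `` {P} = rel `` {Q}"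
    then have "(P, Q) \<in> rel"
      using eq_equiv_class[OF PQ(3) equiv_rel] subgroup_reps by blast
    then have "rep P = rep Q" using PQ rep_eq_iff subgroup_reps by blast
    then show "P = Q" using PQ rep_reps by metis
  qed
  have "rel `` {P} \<in> (\<lambda>Q. rel `` {Q}) ` reps" if "subgroup P H" for P
    using equiv_class_eq[OF equiv_rel rep(1)[OF that]] rep_in_reps[OF that] by blast
  then show "(\<lambda>Q. rel `` {Q}) ` reps = subgroup_conj_classes G S"
    unfolding subgroup_conj_classes_def using subgroup_reps by (auto simp: quotient_def)
qed

lemma card_reps: "card reps = card (subgroup_conj_classes G S)"
  using bij_reps_classes by (rule bij_betw_same_card)

text \<open>The number of orbits isomorphic to \<open>S/Q\<close>, since each of them has \<open>|N\<^sub>S(Q)| / |Q|\<close> points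
  with stabilizer \<open>Q\<close>.\<close>

definition orbit_number :: "('a, 'x) gset \<Rightarrow> 'a set \<Rightarrow> nat" where
  "orbit_number X Q = nstab H X Q * card Q div card (set_normalizer H Q)"

lemma card_set_normalizer_pos: "subgroup Q H \<Longrightarrow> card (set_normalizer H Q) > 0"
  using H.finite_subgroup[OF H.subgroup_set_normalizer[OF subgroup.subset]]
    subgroup.one_closed[OF H.subgroup_set_normalizer[OF subgroup.subset]]
  by (metis card_gt_0_iff empty_iff)

lemma card_subgroup_pos: "subgroup Q H \<Longrightarrow> card Q > 0"
  using H.finite_subgroup subgroup.one_closed by (metis card_gt_0_iff empty_iff)

lemma orbit_number_mult:
  assumes "finite_gset H X" "subgroup Q H"
  shows "orbit_number X Q * card (set_normalizer H Q) = nstab H X Q * card Q"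
  unfolding orbit_number_def using H.set_normalizer_dvd_nstab[OF assms] by simp

lemma orbit_number_eqI:
  assumes "subgroup Q H" "nstab H X Q * card Q = m * card (set_normalizer H Q)"
  shows "orbit_number X Q = m"
  unfolding orbit_number_def using assms card_set_normalizer_pos by simp

lemma orbit_number_iso:
  "\<lbrakk>finite_gset H X; gset_iso H X Y\<rbrakk> \<Longrightarrow> orbit_number X Q = orbit_number Y Q"
  using H.nstab_iso[of X Y Q] by (simp add: orbit_number_def)

lemma orbit_number_empty: "orbit_number empty_gset Q = 0"
  by (simp add: orbit_number_def nstab_empty)

lemma orbit_number_sum:
  assumes "finite_gset H X" "finite_gset H Y" "subgroup Q H"
  shows "orbit_number (gset_sum X Y) Q = orbit_number X Q + orbit_number Y Q"
  using assms orbit_number_mult[OF assms(1,3)] orbit_number_mult[OF assms(2,3)]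
  by (intro orbit_number_eqI) (simp_all add: nstab_sum H.finite_points algebra_simps)

lemma orbit_number_coprod:
  assumes "finite I" "\<And>i. i \<in> I \<Longrightarrow> finite_gset H (Y i)" "subgroup Q H"
  shows "orbit_number (gset_coprod I Y) Q = (\<Sum>i\<in>I. orbit_number (Y i) Q)"
proof (rule orbit_number_eqI[OF assms(3)])
  have "nstab H (gset_coprod I Y) Q * card Q = (\<Sum>i\<in>I. nstab H (Y i) Q * card Q)"
    using assms by (simp add: nstab_coprod H.finite_points sum_distrib_right)
  also have "\<dots> = (\<Sum>i\<in>I. orbit_number (Y i) Q * card (set_normalizer H Q))"
    using assms by (intro sum.cong) (simp_all add: orbit_number_mult)
  finally show "nstab H (gset_coprod I Y) Q * card Q =
      (\<Sum>i\<in>I. orbit_number (Y i) Q) * card (set_normalizer H Q)"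
    by (simp add: sum_distrib_right)
qed

lemma mark_split:
  assumes "finite_gset H X" "subgroup R H"
  shows "mark X R = nstab H X R + (\<Sum>Q | subgroup Q H \<and> R \<subset> Q. nstab H X Q)"
proof -
  have "{Q. Q \<in> {Q. subgroup Q H} \<and> R \<subseteq> Q} = insert R {Q. subgroup Q H \<and> R \<subset> Q}"
    using assms(2) by auto
  moreover have "finite {Q. subgroup Q H \<and> R \<subset> Q}"
    by (rule finite_subset[OF _ H.finite_subgroups]) auto
  ultimately show ?thesis
    using H.mark_eq_sum_nstab[OF assms(1) subgroup.subset[OF assms(2)]] by simp
qed

lemma card_psubset_subgroup: "\<lbrakk>subgroup Q H; R \<subset> Q\<rbrakk> \<Longrightarrow> card R < card Q"
  using H.finite_subgroup psubset_card_mono by blast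

text \<open>With the counts at larger subgroups known to agree, the orbit number at
  \<open>rep R\<close> fixes the count there and hence the mark there. Stability transports this
  mark to \<open>R\<close>, and subtracting the larger terms gives the count at
  \<open>R\<close>.\<close>

theorem stable_iso_if_orbit_numbers:
  assumes X: "stable_gset G S X" and Y: "stable_gset G S Y"
    and eq: "\<And>Q. Q \<in> reps \<Longrightarrow> orbit_number X Q = orbit_number Y Q"
  shows "gset_iso H X Y"
proof -
  have fin: "finite_gset H X" "finite_gset H Y" using X Y by (auto intro: stable_imp_finite)
  have "nstab H X R = nstab H Y R" if "subgroup R H" for R
    using that
  proof (induction "card S - card R" arbitrary: R rule: less_induct)
    case less
    have larger: "nstab H X Q = nstab H Y Q" if Q: "subgroup Q H" "card R < card Q" for Q
    proof -
      have "card Q \<le> card S"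
        using Q S.subset fin_G finite_subset by (intro card_mono) (auto simp: subgroup_H_iff)
      then show ?thesis using Q by (intro less.hyps) auto
    qed
    \<comment> \<open>Stated for every \<open>T\<close> of the order of \<open>R\<close>, since it
      is applied both at \<open>R\<close> and at \<open>rep R\<close>.\<close>
    have sums: "(\<Sum>P | subgroup P H \<and> T \<subset> P. nstab H X P) =
        (\<Sum>P | subgroup P H \<and> T \<subset> P. nstab H Y P)" if "card T = card R" for T
    proof (rule sum.cong)
      fix P assume P: "P \<in> {P. subgroup P H \<and> T \<subset> P}"
      then have "card R < card P" using card_psubset_subgroup[of P T] that by auto
      with P show "nstab H X P = nstab H Y P" using larger by blast
    qed simp
    let ?Q = "rep R"
    have Q: "subgroup ?Q H" "(R, ?Q) \<in> rel" using less.prems subgroup_rep rep(1) by auto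
    have cQ: "card ?Q = card R" using rel_card[OF Q(2)] .
    have "nstab H X ?Q * card ?Q = nstab H Y ?Q * card ?Q"
      using eq[OF rep_in_reps[OF less.prems]] orbit_number_mult[OF fin(1) Q(1)]
        orbit_number_mult[OF fin(2) Q(1)] by metis
    then have "nstab H X ?Q = nstab H Y ?Q" using card_subgroup_pos[OF Q(1)] by simp
    then have "mark X ?Q = mark Y ?Q" using sums[OF cQ] by (simp add: mark_split[OF _ Q(1)] fin)
    then have "mark X R = mark Y R" using X Y Q(2) unfolding stable_gset_iff_rel by metis
    then show ?case using sums[OF refl] by (simp add: mark_split[OF _ less.prems] fin)
  qed
  then show ?thesis using fin by (simp add: H.gset_iso_iff_nstab)
qed

text \<open>A \<open>G\<close>-class may consist of several \<open>S\<close>-classes. This singles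
  out the one containing the representative, where the number of orbits is prescribed; on the others
  it can be adjusted.\<close>

definition rep_conj :: "'a set \<Rightarrow> bool" where
  "rep_conj R \<longleftrightarrow> (\<exists>s\<in>S. R = conj_set G s (rep R))"

text \<open>Here \<open>k\<close> bounds the order of the subgroups at which stability has not been achieved
  yet. Up to that order only orbits of type \<open>S/Q\<close> with \<open>Q\<close> a representative occur, so the
  marks there can be corrected by adding orbits of the remaining types.\<close>

definition stable_above :: "nat \<Rightarrow> ('a set \<Rightarrow> nat) \<Rightarrow> ('a, 'x) gset \<Rightarrow> bool" where
  "stable_above k v X \<longleftrightarrow> finite_gset H X \<and>
    (\<forall>P Q. (P, Q) \<in> rel \<longrightarrow> k < card P \<longrightarrow> mark X Q = mark X P) \<and>
    (\<forall>Q\<in>reps. orbit_number X Q = v Q) \<and>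
    (\<forall>R. subgroup R H \<longrightarrow> card R \<le> k \<longrightarrow> \<not> rep_conj R \<longrightarrow> nstab H X R = 0)"

lemma conj_set_rel:
  assumes "subgroup R H" "s \<in> S"
  shows "subgroup (conj_set G s R) H" "(R, conj_set G s R) \<in> rel"
proof -
  have "conj_set G s R \<subseteq> S"
    using assms by (auto simp: conj_set_def subgroup_H_iff)
  then show "subgroup (conj_set G s R) H"
    using assms subgroup_conj_set by (auto simp: subgroup_H_iff)
  then show "(R, conj_set G s R) \<in> rel" using assms by (auto simp: rel_iff)
qed

lemma rep_conj_conj_set:
  assumes "subgroup R H" "s \<in> S"
  shows "rep_conj (conj_set G s R) \<longleftrightarrow> rep_conj R"
proof -
  have eq: "rep (conj_set G s R) = rep R"
    using rep_eq_iff conj_set_rel[OF assms] assms(1) by blast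
  have sub: "rep R \<subseteq> carrier G" "R \<subseteq> carrier G"
    using subgroup_rep[OF assms(1)] assms(1) subgroup_H_subset by auto
  show ?thesis
  proof
    assume "rep_conj R"
    then obtain t where t: "t \<in> S" "R = conj_set G t (rep R)" by (auto simp: rep_conj_def)
    have "conj_set G s R = conj_set G (s \<otimes> t) (rep R)"
      using t assms(2) sub by (simp add: conj_set_mult)
    then show "rep_conj (conj_set G s R)"
      unfolding rep_conj_def eq using t assms(2) by blast
  next
    assume "rep_conj (conj_set G s R)"
    then obtain t where t: "t \<in> S" "conj_set G s R = conj_set G t (rep R)"
      by (auto simp: rep_conj_def eq)
    have "R = conj_set G (inv s) (conj_set G s R)" using assms(2) sub by simp
    also have "\<dots> = conj_set G (inv s \<otimes> t) (rep R)"
      using t assms(2) sub by (simp add: conj_set_mult)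
    finally show "rep_conj R" unfolding rep_conj_def using t assms(2) by blast
  qed
qed

lemma rep_conj_reps: "Q \<in> reps \<Longrightarrow> rep_conj Q"
  using subgroup_H_subset[OF subgroup_reps] by (auto simp: rep_conj_def intro!: bexI[of _ \<one>])

text \<open>No subgroup has order above \<open>card S\<close>, so stability asks for nothing yet and
  the disjoint union of \<open>v Q\<close> copies of S/Q over all representatives will do.\<close>

lemma stable_above_start:
  "\<exists>X :: ('a, nat) gset. stable_above (card S) v X"
proof -
  let ?I = "SIGMA Q:reps. {..<v Q}"
  let ?X = "gset_coprod ?I (\<lambda>(Q, i). H.coset_gset Q)"
  have finI: "finite ?I" using finite_reps by simp
  have coset: "finite_gset H (H.coset_gset Q)" if "Q \<in> reps" for Q
    using that H.finite_gset_coset subgroup_reps by blast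
  have finX: "finite_gset H ?X"
    by (rule H.finite_gset_coprod) (use finI coset in auto)
  have nstab: "nstab H ?X R = (\<Sum>Q\<in>reps. v Q * nstab H (H.coset_gset Q) R)" for R
  proof -
    have "nstab H ?X R = (\<Sum>(Q, i)\<in>?I. nstab H (H.coset_gset Q) R)"
      by (subst nstab_coprod) (use finI H.finite_points[OF coset] in \<open>auto simp: case_prod_unfold\<close>)
    also have "\<dots> = (\<Sum>Q\<in>reps. \<Sum>i<v Q. nstab H (H.coset_gset Q) R)"
      using finite_reps by (subst sum.Sigma) auto
    finally show ?thesis by simp
  qed
  \<comment> \<open>Stabilizers in S/Q are \<open>S\<close>-conjugates of \<open>Q\<close>; these
    have \<open>Q\<close> as representative and satisfy \<open>rep_conj\<close>.\<close>
  have zero: "nstab H (H.coset_gset Q) R = 0"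
    if "Q \<in> reps" "subgroup R H" "Q \<noteq> rep R \<or> \<not> rep_conj R" for Q R
  proof (rule H.nstab_coset_eq_0)
    show "subgroup Q H" using that subgroup_reps by blast
    fix s assume "s \<in> carrier H"
    then have s: "s \<in> S" by simp
    show "conj_set H s Q \<noteq> R"
    proof
      assume "conj_set H s Q = R"
      then have R: "R = conj_set G s Q"
        using s \<open>subgroup Q H\<close> by (auto simp: conj_set_H subgroup_H_iff)
      then have "rep R = Q"
        using conj_set_rel[OF \<open>subgroup Q H\<close> s] rep_eq_iff[OF \<open>subgroup Q H\<close> that(2)]
          rep_reps[OF that(1)] by simp
      then show False using that(3) R s unfolding rep_conj_def by metis
    qed
  qed
  have "orbit_number ?X Q = v Q" if Q: "Q \<in> reps" for Q
  proof (rule orbit_number_eqI)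
    show sub: "subgroup Q H" using Q by (rule subgroup_reps)
    have "nstab H ?X Q = (\<Sum>P\<in>reps. if P = Q then v Q * nstab H (H.coset_gset Q) Q else 0)"
      unfolding nstab using zero[OF _ sub] Q by (intro sum.cong) auto
    then show "nstab H ?X Q * card Q = v Q * card (set_normalizer H Q)"
      using Q finite_reps H.nstab_coset_self[OF sub] by (simp add: mult.assoc)
  qed
  moreover have "nstab H ?X R = 0" if "subgroup R H" "\<not> rep_conj R" for R
    unfolding nstab using zero that by simp
  moreover have "\<not> card S < card P" if "(P, Q) \<in> rel" for P Q
    using that card_mono[OF finite_subgroup[OF S.subgroup_axioms], of P] by (auto simp: rel_iff subgroup_H_iff)
  ultimately have X: "stable_above (card S) v ?X"
    using finX by (auto simp: stable_above_def)
  obtain Y :: "('a, nat) gset" where Y: "finite_gset H Y" "gset_iso H ?X Y"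
    using H.gset_transport_nat[OF finX] by blast
  have "mark Y R = mark ?X R" if "subgroup R H" for R
    using Y finX that H.gset_iso_iff_mark by metis
  then have "stable_above (card S) v Y"
    using X Y H.nstab_iso[OF finX Y(2)] orbit_number_iso[OF finX Y(2)]
    by (auto simp: stable_above_def rel_iff)
  then show ?thesis by blast
qed

text \<open>Only the counts at order \<open>Suc k\<close> outside the \<open>S\<close>-classes of
  the representatives are raised. Marks at larger subgroups and the prescribed orbit numbers stay
  the same, and at smaller subgroups the unadjusted counts remain zero.\<close>

lemma stable_above_step:
  fixes X :: "('a, nat) gset"
  assumes "stable_above (Suc k) v X"
  shows "\<exists>Y :: ('a, nat) gset. stable_above k v Y"
proof -
  have finX: "finite_gset H X"
    and marks: "\<And>P Q. \<lbrakk>(P, Q) \<in> rel; Suc k < card P\<rbrakk> \<Longrightarrow> mark X Q = mark X P"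
    and orb: "\<And>Q. Q \<in> reps \<Longrightarrow> orbit_number X Q = v Q"
    and zero: "\<And>R. \<lbrakk>subgroup R H; card R \<le> Suc k; \<not> rep_conj R\<rbrakk> \<Longrightarrow> nstab H X R = 0"
    using assms by (auto simp: stable_above_def)
  \<comment> \<open>In the first case the old count is zero, so the new count is exactly what the
    mark at \<open>R\<close> lacks.\<close>
  define f where "f R = (if card R = Suc k \<and> \<not> rep_conj R then mark X (rep R) - mark X R
    else nstab H X R)" for R
  \<comment> \<open>Since \<open>rep R\<close> is well placed, some \<open>g\<close> takes
    \<open>R\<close> to it and the normalizer of \<open>R\<close> into \<open>S\<close>. The marks
    above are settled and there are no points with stabilizer \<open>R\<close>, which is what
    \<open>mark_diff_dvd\<close> requires.\<close>
  have diff: "mark X R \<le> mark X (rep R)"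
      "card (set_normalizer H R) dvd (mark X (rep R) - mark X R) * card R"
    if R: "subgroup R H" "card R = Suc k" "\<not> rep_conj R" for R
  proof -
    obtain g where g: "g \<in> carrier G" "conj_set G g R = rep R" "conj_set G g (set_normalizer H R) \<subseteq> S"
      using rep[OF R(1)] by (auto simp: well_placed_def)
    have "mark X P = mark X Q" if "(P, Q) \<in> rel" "card R < card P" for P Q
      using marks[of P Q] that R(2) by simp
    from mark_diff_dvd[OF finX R(1) g(1,3) this zero[OF R(1)]] R(2,3) g(2)
    show "mark X R \<le> mark X (rep R)"
      "card (set_normalizer H R) dvd (mark X (rep R) - mark X R) * card R"
      by auto
  qed
  have markS: "mark X (conj_set G s R) = mark X R" if "s \<in> S" "subgroup R H" for s R
    using H.mark_conj_set[OF finX, of s R] that by (simp add: conj_set_H subgroup_H_iff)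
  have "\<exists>Y :: ('a, nat) gset. finite_gset H Y \<and> (\<forall>R. subgroup R H \<longrightarrow> nstab H Y R = f R)"
  proof (rule H.gset_with_nstab)
    fix s R assume "s \<in> carrier H" and R: "subgroup R H"
    then have s: "s \<in> S" by simp
    have "conj_set H s R = conj_set G s R" "card (conj_set G s R) = card R"
      "rep (conj_set G s R) = rep R"
      using s R conj_set_rel[OF R s] rep_eq_iff[of R "conj_set G s R"]
        rel_card[of R "conj_set G s R"]
      by (auto simp: conj_set_H subgroup_H_iff)
    moreover have "nstab H X (conj_set H s R) = nstab H X R"
      using H.nstab_conj_set[OF finX] s R by (simp add: subgroup_H_iff)
    ultimately show "f (conj_set H s R) = f R"
      using markS[OF s R] rep_conj_conj_set[OF R s] by (simp add: f_def)
  next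
    fix R assume R: "subgroup R H"
    then show "card (set_normalizer H R) dvd f R * card R"
      using diff(2)[OF R] H.set_normalizer_dvd_nstab[OF finX R] by (simp add: f_def)
  qed
  then obtain Y :: "('a, nat) gset"
    where finY: "finite_gset H Y" and Y: "\<And>R. subgroup R H \<Longrightarrow> nstab H Y R = f R" by blast
  \<comment> \<open>Counts change only at order exactly \<open>Suc k\<close>, hence nowhere strictly
    above a subgroup of at least that order.\<close>
  have rest: "(\<Sum>Q | subgroup Q H \<and> R \<subset> Q. nstab H Y Q) = (\<Sum>Q | subgroup Q H \<and> R \<subset> Q. nstab H X Q)"
    if R: "subgroup R H" "Suc k \<le> card R" for R
  proof (rule sum.cong)
    fix Q assume Q: "Q \<in> {Q. subgroup Q H \<and> R \<subset> Q}"
    then have "card R < card Q" using card_psubset_subgroup by blast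
    then show "nstab H Y Q = nstab H X Q" using Q R Y by (simp add: f_def)
  qed simp
  have larger: "mark Y R = mark X R" if R: "subgroup R H" "Suc k < card R" for R
    using mark_split[OF finX R(1)] mark_split[OF finY R(1)] rest[OF R(1)] R Y by (simp add: f_def)
  \<comment> \<open>The target is the old mark of the representative, which is also its new mark.
    All marks in a class at this order therefore become equal.\<close>
  have level: "mark Y R = mark X (rep R)" if R: "subgroup R H" "card R = Suc k" for R
  proof (cases "rep_conj R")
    case True
    then have "mark Y R = mark X R"
      using mark_split[OF finX R(1)] mark_split[OF finY R(1)] rest[OF R(1)] R Y by (simp add: f_def)
    moreover obtain s where "s \<in> S" "R = conj_set G s (rep R)"
      using True by (auto simp: rep_conj_def)
    then have "mark X R = mark X (rep R)"
      using markS subgroup_rep[OF R(1)] by metis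
    ultimately show ?thesis by simp
  next
    case False
    then have "mark Y R = f R + mark X R"
      using mark_split[OF finX R(1)] mark_split[OF finY R(1)] rest[OF R(1)] R Y zero[OF R(1)]
      by simp
    then show ?thesis using False R diff(1)[OF R(1)] by (simp add: f_def)
  qed
  have "mark Y Q = mark Y P" if PQ: "(P, Q) \<in> rel" "k < card P" for P Q
  proof -
    have sub: "subgroup P H" "subgroup Q H" using PQ(1) by (auto simp: rel_iff)
    have c: "card Q = card P" using PQ(1) by (rule rel_card)
    show ?thesis
    proof (cases "card P = Suc k")
      case True
      moreover have "rep P = rep Q" using PQ(1) sub by (simp add: rep_eq_iff)
      ultimately show ?thesis using level sub c by simp
    next
      case False
      then have "Suc k < card P" using PQ(2) by simp
      then show ?thesis using larger sub c marks[OF PQ(1)] by simp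
    qed
  qed
  moreover have "orbit_number Y Q = v Q" if "Q \<in> reps" for Q
    using orb[OF that] Y[OF subgroup_reps[OF that]] rep_conj_reps[OF that]
    by (simp add: orbit_number_def f_def)
  moreover have "nstab H Y R = 0" if "subgroup R H" "card R \<le> k" "\<not> rep_conj R" for R
    using that zero Y by (simp add: f_def)
  ultimately have "stable_above k v Y"
    using finY by (auto simp: stable_above_def)
  then show ?thesis by blast
qed

theorem ex_stable_with_orbit_numbers:
  "\<exists>X :: ('a, nat) gset. stable_gset G S X \<and> (\<forall>Q\<in>reps. orbit_number X Q = v Q)"
proof -
  \<comment> \<open>Here \<open>j\<close> counts the orders already treated; truncated subtraction
    makes the steps beyond \<open>card S\<close> trivial.\<close>
  have "\<exists>X :: ('a, nat) gset. stable_above (card S - j) v X" for j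
  proof (induction j)
    case 0
    then show ?case using stable_above_start by simp
  next
    case (Suc j)
    show ?case
    proof (cases "j < card S")
      case True
      then have "card S - j = Suc (card S - Suc j)" by simp
      then show ?thesis using Suc stable_above_step by metis
    next
      case False
      then show ?thesis using Suc by simp
    qed
  qed
  from this[of "card S"] obtain X :: "('a, nat) gset" where X: "stable_above 0 v X" by auto
  \<comment> \<open>Every subgroup has positive order, so the bound zero leaves none out.\<close>
  have "mark X Q = mark X P" if "(P, Q) \<in> rel" for P Q
  proof -
    have "card P > 0" using that card_subgroup_pos by (auto simp: rel_iff)
    then show ?thesis using X that by (auto simp: stable_above_def)
  qed
  then have "stable_gset G S X"
    using X by (auto simp: stable_above_def stable_gset_iff_rel)
  then show ?thesis using X by (auto simp: stable_above_def)
qed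

end

section \<open>Irreducible stable sets\<close>

text \<open>Bijections between fibres over the same label are glued. It serves to match the summands
  of two splittings by type.\<close>

lemma ex_bij_betw_fibers:
  assumes "finite A" "finite B" "\<And>c. card {a \<in> A. q a = c} = card {b \<in> B. r b = c}"
  shows "\<exists>\<sigma>. bij_betw \<sigma> A B \<and> (\<forall>a\<in>A. r (\<sigma> a) = q a)"
proof -
  have "\<exists>f. bij_betw f {a \<in> A. q a = c} {b \<in> B. r b = c}" for c
    by (rule finite_same_card_bij) (use assms in auto)
  then obtain \<beta> where \<beta>: "\<And>c. bij_betw (\<beta> c) {a \<in> A. q a = c} {b \<in> B. r b = c}" by metis
  define \<sigma> where "\<sigma> a = \<beta> (q a) a" for a
  have \<sigma>: "\<sigma> a \<in> B \<and> r (\<sigma> a) = q a" if "a \<in> A" for a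
    using bij_betwE[OF \<beta>[of "q a"]] that by (auto simp: \<sigma>_def)
  have "inj_on \<sigma> A"
  proof (rule inj_onI)
    fix a a' assume *: "a \<in> A" "a' \<in> A" "\<sigma> a = \<sigma> a'"
    then have "q a = q a'" using \<sigma> by metis
    then show "a = a'"
      using * bij_betw_imp_inj_on[OF \<beta>[of "q a"]] by (auto simp: \<sigma>_def dest: inj_onD)
  qed
  moreover have "B \<subseteq> \<sigma> ` A"
  proof
    fix b assume "b \<in> B"
    then have "b \<in> \<beta> (r b) ` {a \<in> A. q a = r b}"
      using bij_betw_imp_surj_on[OF \<beta>[of "r b"]] by auto
    then obtain a where "a \<in> A" "q a = r b" "b = \<beta> (r b) a" by blast
    then show "b \<in> \<sigma> ` A" by (intro image_eqI[of _ _ a]) (simp_all add: \<sigma>_def)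
  qed
  ultimately show ?thesis using \<sigma> unfolding bij_betw_def by blast
qed

context sylow_pair
begin

text \<open>For \<open>Q\<close> in \<open>reps\<close> the vector of orbit numbers is the unit
  vector at \<open>Q\<close>; for other \<open>Q\<close> it is zero and \<open>X\<close> is
  empty.\<close>

definition basic :: "('a, 'x) gset \<Rightarrow> 'a set \<Rightarrow> bool" where
  "basic X Q \<longleftrightarrow> stable_gset G S X \<and> (\<forall>P\<in>reps. orbit_number X P = (if P = Q then 1 else 0))"

text \<open>A stable set without orbits of representative type has the same coordinates as the empty
  set and is isomorphic to it by the classification.\<close>

lemma points_eq_empty_iff:
  assumes "stable_gset G S X"
  shows "points X = {} \<longleftrightarrow> (\<forall>Q\<in>reps. orbit_number X Q = 0)"
proof
  assume "points X = {}"
  then show "\<forall>Q\<in>reps. orbit_number X Q = 0"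
    by (simp add: orbit_number_def nstab_def stab_points_def)
next
  assume "\<forall>Q\<in>reps. orbit_number X Q = 0"
  then have "gset_iso H X (empty_gset :: ('a, nat) gset)"
    using assms by (intro stable_iso_if_orbit_numbers) (auto simp: stable_empty orbit_number_empty)
  then show "points X = {}"
    by (auto simp: gset_iso_def empty_gset_def bij_betw_def)
qed

lemma orbit_number_iso_sum:
  assumes "stable_gset G S X" "stable_gset G S Y" "stable_gset G S Z"
    and "gset_iso H X (gset_sum Y Z)" "Q \<in> reps"
  shows "orbit_number X Q = orbit_number Y Q + orbit_number Z Q"
  using orbit_number_iso[OF stable_imp_finite[OF assms(1)] assms(4)]
    orbit_number_sum[OF stable_imp_finite[OF assms(2)] stable_imp_finite[OF assms(3)]
      subgroup_reps[OF assms(5)]]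
  by simp

text \<open>The unit vector at \<open>Q\<close> and the remaining vector are realized on
  \<open>nat\<close>, and by the classification their sum is isomorphic to \<open>X\<close>. Both
  summands are then moved along the isomorphism into the point type of \<open>X\<close>, because
  irreducibility quantifies over summands of that type.\<close>

lemma split_off_basic:
  fixes X :: "('a, 'x) gset"
  assumes X: "stable_gset G S X" and Q: "Q \<in> reps" and pos: "orbit_number X Q > 0"
  obtains Y Z :: "('a, 'x) gset" where "basic Y Q" "stable_gset G S Z" "gset_iso H X (gset_sum Y Z)"
proof -
  obtain Y0 :: "('a, nat) gset" where Y0: "stable_gset G S Y0"
      "\<And>P. P \<in> reps \<Longrightarrow> orbit_number Y0 P = (if P = Q then 1 else 0)"
    using ex_stable_with_orbit_numbers[of "\<lambda>P. if P = Q then 1 else 0"] by blast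
  obtain Z0 :: "('a, nat) gset" where Z0: "stable_gset G S Z0"
      "\<And>P. P \<in> reps \<Longrightarrow> orbit_number Z0 P = orbit_number X P - (if P = Q then 1 else 0)"
    using ex_stable_with_orbit_numbers[of "\<lambda>P. orbit_number X P - (if P = Q then 1 else 0)"] by blast
  have "gset_iso H (gset_sum Y0 Z0) X"
    using X Y0 Z0 pos
    by (intro stable_iso_if_orbit_numbers stable_sum)
       (auto simp: orbit_number_sum stable_imp_finite subgroup_reps)
  then obtain f where f: "bij_betw f (points Y0 <+> points Z0) (points X)"
    by (auto simp: gset_iso_def gset_sum_def)
  then have inj: "inj_on f (points Y0 <+> points Z0)" by (rule bij_betw_imp_inj_on)
  have "inj_on (\<lambda>y. f (Inl y)) (points Y0)" "inj_on (\<lambda>z. f (Inr z)) (points Z0)"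
    using inj by (auto simp: inj_on_def)
  then obtain Y Z :: "('a, 'x) gset"
    where Y: "finite_gset H Y" "gset_iso H Y0 Y" and Z: "finite_gset H Z" "gset_iso H Z0 Z"
    using H.gset_transport stable_imp_finite[OF Y0(1)] stable_imp_finite[OF Z0(1)] by metis
  have st: "stable_gset G S Y" "stable_gset G S Z"
    using stable_iso[OF Y0(1) Y] stable_iso[OF Z0(1) Z] by auto
  have orb: "orbit_number Y P = orbit_number Y0 P" "orbit_number Z P = orbit_number Z0 P" for P
    using orbit_number_iso[OF stable_imp_finite[OF Y0(1)] Y(2)]
      orbit_number_iso[OF stable_imp_finite[OF Z0(1)] Z(2)] by auto
  show thesis
  proof
    show "basic Y Q" using st Y0 orb by (simp add: basic_def)
    show "gset_iso H X (gset_sum Y Z)"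
      using X st Y0 Z0 orb pos
      by (intro stable_iso_if_orbit_numbers stable_sum)
         (auto simp: orbit_number_sum stable_imp_finite subgroup_reps)
  qed fact
qed

lemma basic_imp_nonempty: "\<lbrakk>basic X Q; Q \<in> reps\<rbrakk> \<Longrightarrow> points X \<noteq> {}"
  by (auto simp: basic_def points_eq_empty_iff)

text \<open>In a monoid of natural vectors the irreducible elements are the unit vectors: a nonzero
  vector has a unit vector as a summand, and a unit vector is not a sum of two nonzero ones.\<close>

theorem irreducible_iff_basic:
  fixes X :: "('a, 'x) gset"
  shows "irreducible_stable_gset G S X \<longleftrightarrow> (\<exists>Q\<in>reps. basic X Q)"
proof
  assume irr: "irreducible_stable_gset G S X"
  then have X: "stable_gset G S X" "points X \<noteq> {}" by (auto simp: irreducible_stable_gset_def)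
  then obtain Q where Q: "Q \<in> reps" "orbit_number X Q > 0"
    by (auto simp: points_eq_empty_iff)
  then obtain Y Z :: "('a, 'x) gset"
    where YZ: "basic Y Q" "stable_gset G S Z" "gset_iso H X (gset_sum Y Z)"
    using split_off_basic X(1) by metis
  have Y: "stable_gset G S Y" "points Y \<noteq> {}"
    using YZ(1) Q(1) basic_imp_nonempty by (auto simp: basic_def)
  then have "points Z = {}"
    using irr YZ unfolding irreducible_stable_gset_def by blast
  then have "orbit_number X P = orbit_number Y P" if "P \<in> reps" for P
    using orbit_number_iso_sum[OF X(1) Y(1) YZ(2,3) that] that
    by (simp add: points_eq_empty_iff[OF YZ(2)])
  then show "\<exists>Q\<in>reps. basic X Q" using X(1) YZ(1) Q(1) by (auto simp: basic_def)
next
  assume "\<exists>Q\<in>reps. basic X Q"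
  then obtain Q where Q: "Q \<in> reps" "basic X Q" by blast
  have X: "stable_gset G S X" using Q by (simp add: basic_def)
  have "False" if Y: "stable_gset G S Y" "points Y \<noteq> {}" and Z: "stable_gset G S Z" "points Z \<noteq> {}"
    and iso: "gset_iso H X (gset_sum Y Z)" for Y Z :: "('a, 'x) gset"
  proof -
    have sum: "orbit_number Y P + orbit_number Z P = (if P = Q then 1 else 0)" if "P \<in> reps" for P
      using orbit_number_iso_sum[OF X Y(1) Z(1) iso that] Q that by (simp add: basic_def)
    obtain P where "P \<in> reps" "orbit_number Y P \<noteq> 0"
      using Y by (auto simp: points_eq_empty_iff)
    moreover obtain P' where "P' \<in> reps" "orbit_number Z P' \<noteq> 0"
      using Z by (auto simp: points_eq_empty_iff)
    ultimately have "orbit_number Y Q \<noteq> 0" "orbit_number Z Q \<noteq> 0"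
      using sum[of P] sum[of P'] by (auto split: if_splits)
    then show False using sum[OF Q(1)] by simp
  qed
  then show "irreducible_stable_gset G S X"
    unfolding irreducible_stable_gset_def using X basic_imp_nonempty[OF Q(2,1)] by blast
qed

lemma basic_iso:
  "\<lbrakk>basic X Q; basic Y Q\<rbrakk> \<Longrightarrow> gset_iso H X Y"
  by (rule stable_iso_if_orbit_numbers) (auto simp: basic_def)

lemma orbit_number_coprod_basic:
  assumes "finite I" "\<And>i. i \<in> I \<Longrightarrow> basic (Y i) (q i)" "P \<in> reps"
  shows "orbit_number (gset_coprod I Y) P = card {i \<in> I. q i = P}"
proof -
  have "orbit_number (gset_coprod I Y) P = (\<Sum>i\<in>I. orbit_number (Y i) P)"
    using assms by (intro orbit_number_coprod) (auto simp: basic_def stable_imp_finite subgroup_reps)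
  also have "\<dots> = (\<Sum>i\<in>I. if q i = P then 1 else 0)"
    using assms by (intro sum.cong) (auto simp: basic_def)
  also have "\<dots> = card {i \<in> I. q i = P}"
    using assms(1) by (simp add: sum.If_cases Int_def conj_commute)
  finally show ?thesis .
qed

text \<open>The coordinates of \<open>X\<close> say how many copies of each basic set to take; the
  bijection \<open>e\<close> numbers these copies by an initial segment of the naturals.\<close>

lemma ex_irreducible_splitting:
  fixes X :: "('a, 'x) gset"
  assumes X: "stable_gset G S X"
  shows "\<exists>n Y. irreducible_splitting G S X n Y"
proof -
  \<comment> \<open>Only types that occur in \<open>X\<close> are claimed: a basic set of another
    type may be too large for the point type of \<open>X\<close>.\<close>
  have "\<exists>Y :: ('a, 'x) gset. basic Y Q" if "Q \<in> reps" "orbit_number X Q > 0" for Q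
    using split_off_basic[OF X that] by metis
  then obtain Y :: "'a set \<Rightarrow> ('a, 'x) gset"
    where Y: "\<And>Q. \<lbrakk>Q \<in> reps; orbit_number X Q > 0\<rbrakk> \<Longrightarrow> basic (Y Q) Q" by metis
  let ?I = "SIGMA Q:reps. {..<orbit_number X Q}"
  have "finite ?I" using finite_reps by simp
  then obtain e where e: "bij_betw e {..<card ?I} ?I"
    using ex_bij_betw_nat_finite by (metis atLeast0LessThan)
  define n where "n = card ?I"
  define q where "q i = fst (e i)" for i
  have q: "q i \<in> reps" "basic (Y (q i)) (q i)" if "i < n" for i
    using bij_betwE[OF e] that Y by (force simp: q_def n_def)+
  let ?Z = "gset_coprod {..<n} (\<lambda>i. Y (q i))"
  have "gset_iso H X ?Z"
  proof (rule stable_iso_if_orbit_numbers[OF X])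
    show "stable_gset G S ?Z"
      by (rule stable_coprod) (use q in \<open>auto simp: basic_def\<close>)
    fix P assume P: "P \<in> reps"
    have "orbit_number ?Z P = card {i \<in> {..<n}. q i = P}"
      by (rule orbit_number_coprod_basic) (use q P in auto)
    also have "\<dots> = card {x \<in> ?I. fst x = P}"
    proof (rule bij_betw_same_card)
      show "bij_betw e {i \<in> {..<n}. q i = P} {x \<in> ?I. fst x = P}"
        unfolding bij_betw_def
      proof
        show "inj_on e {i \<in> {..<n}. q i = P}"
          using bij_betw_imp_inj_on[OF e] by (rule inj_on_subset) (auto simp: n_def)
        show "e ` {i \<in> {..<n}. q i = P} = {x \<in> ?I. fst x = P}"
        proof -
          have "e ` {i \<in> {..<n}. q i = P} = {x \<in> e ` {..<n}. fst x = P}" by (auto simp: q_def)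
          then show ?thesis using bij_betw_imp_surj_on[OF e] unfolding n_def by simp
        qed
      qed
    qed
    also have "{x \<in> ?I. fst x = P} = {P} \<times> {..<orbit_number X P}" using P by auto
    finally show "orbit_number X P = orbit_number ?Z P" by (simp add: card_cartesian_product)
  qed
  then have "irreducible_splitting G S X n (\<lambda>i. Y (q i))"
    using q by (auto simp: irreducible_splitting_def irreducible_iff_basic)
  then show ?thesis by blast
qed

text \<open>The number of summands of type \<open>P\<close> is the orbit number of \<open>X\<close>
  at \<open>P\<close>. Two splittings thus have equally many summands of each type, and basic sets
  of equal type are isomorphic.\<close>

lemma irreducible_splitting_unique:
  fixes X :: "('a, 'x) gset"
  assumes X: "stable_gset G S X"
    and Y: "irreducible_splitting G S X n Y" and Z: "irreducible_splitting G S X m Z"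
  shows "\<exists>\<sigma>. bij_betw \<sigma> {..<n} {..<m} \<and> (\<forall>i<n. gset_iso H (Y i) (Z (\<sigma> i)))"
proof -
  have *: "\<exists>q. (\<forall>i<k. q i \<in> reps \<and> basic (W i) (q i)) \<and>
      (\<forall>P\<in>reps. card {i \<in> {..<k}. q i = P} = orbit_number X P)"
    if W: "irreducible_splitting G S X k W" for k and W :: "nat \<Rightarrow> ('a, 'x) gset"
  proof -
    obtain q where q: "\<forall>i<k. q i \<in> reps \<and> basic (W i) (q i)"
      using W unfolding irreducible_splitting_def irreducible_iff_basic by metis
    have "card {i \<in> {..<k}. q i = P} = orbit_number X P" if P: "P \<in> reps" for P
    proof -
      have "orbit_number X P = orbit_number (gset_coprod {..<k} W) P"
        using orbit_number_iso[OF stable_imp_finite[OF X]] W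
        unfolding irreducible_splitting_def by blast
      also have "\<dots> = card {i \<in> {..<k}. q i = P}"
        by (rule orbit_number_coprod_basic) (use q P in auto)
      finally show ?thesis by simp
    qed
    with q show ?thesis by blast
  qed
  obtain q where q: "\<forall>i<n. q i \<in> reps \<and> basic (Y i) (q i)"
    "\<forall>P\<in>reps. card {i \<in> {..<n}. q i = P} = orbit_number X P" using *[OF Y] by blast
  obtain r where r: "\<forall>i<m. r i \<in> reps \<and> basic (Z i) (r i)"
    "\<forall>P\<in>reps. card {i \<in> {..<m}. r i = P} = orbit_number X P" using *[OF Z] by blast
  have "card {i \<in> {..<n}. q i = P} = card {i \<in> {..<m}. r i = P}" for P
  proof (cases "P \<in> reps")
    case True
    then show ?thesis using q(2) r(2) by simp
  next
    case False
    then have "{i \<in> {..<n}. q i = P} = {}" "{i \<in> {..<m}. r i = P} = {}" using q(1) r(1) by auto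
    then show ?thesis by (simp only: card.empty)
  qed
  then obtain \<sigma> where \<sigma>: "bij_betw \<sigma> {..<n} {..<m}" "\<forall>i\<in>{..<n}. r (\<sigma> i) = q i"
    using ex_bij_betw_fibers[of "{..<n}" "{..<m}" q r] by auto
  have "gset_iso H (Y i) (Z (\<sigma> i))" if "i < n" for i
  proof (rule basic_iso)
    show "basic (Y i) (q i)" using q that by blast
    show "basic (Z (\<sigma> i)) (q i)"
      using r(1) \<sigma> that bij_betwE[OF \<sigma>(1)] by (metis lessThan_iff)
  qed
  with \<sigma>(1) show ?thesis by blast
qed

section \<open>Classes of irreducible stable sets\<close>

definition basic_class :: "'a set \<Rightarrow> ('a, nat) gset set" where
  "basic_class Q = gset_class H (SOME X :: ('a, nat) gset. basic X Q)"

lemma ex_basic: "\<exists>X :: ('a, nat) gset. basic X Q"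
  using ex_stable_with_orbit_numbers[of "\<lambda>P. if P = Q then 1 else 0"] by (simp add: basic_def)

lemma basic_class_eq:
  assumes "basic X Q"
  shows "basic_class Q = gset_class H X"
proof -
  have *: "basic (SOME X :: ('a, nat) gset. basic X Q) Q" using ex_basic by (rule someI_ex)
  then show ?thesis
    unfolding basic_class_def using assms basic_iso[OF * assms]
    by (subst H.gset_class_eq_iff) (auto simp: basic_def stable_imp_finite)
qed

lemma bij_basic_class: "bij_betw basic_class reps (irreducible_classes G S)"
  unfolding bij_betw_def
proof
  show "inj_on basic_class reps"
  proof (rule inj_onI)
    fix P Q assume PQ: "P \<in> reps" "Q \<in> reps" "basic_class P = basic_class Q"
    obtain X Y :: "('a, nat) gset" where XY: "basic X P" "basic Y Q" using ex_basic by metis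
    have fin: "finite_gset H X" "finite_gset H Y"
      using XY by (auto simp: basic_def stable_imp_finite)
    have "gset_iso H X Y"
      using PQ(3) H.gset_class_eq_iff[OF fin] basic_class_eq[OF XY(1)] basic_class_eq[OF XY(2)] by simp
    then have "orbit_number X P = orbit_number Y P" using orbit_number_iso fin by blast
    then show "P = Q" using XY PQ(1) by (auto simp: basic_def split: if_splits)
  qed
  show "basic_class ` reps = irreducible_classes G S"
  proof (intro equalityI subsetI)
    fix x assume "x \<in> basic_class ` reps"
    then obtain Q where Q: "Q \<in> reps" "x = basic_class Q" by blast
    moreover obtain X :: "('a, nat) gset" where "basic X Q" using ex_basic by blast
    ultimately show "x \<in> irreducible_classes G S"
      using basic_class_eq by (auto simp: irreducible_classes_def irreducible_iff_basic)
  next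
    fix x assume "x \<in> irreducible_classes G S"
    then obtain X :: "('a, nat) gset" and Q where "Q \<in> reps" "basic X Q" "x = gset_class H X"
      by (auto simp: irreducible_classes_def irreducible_iff_basic)
    then show "x \<in> basic_class ` reps" using basic_class_eq[of X Q] by blast
  qed
qed

section \<open>The semiring of stable sets\<close>

abbreviation M where "M \<equiv> stable_semiring G S"
abbreviation cls where "cls \<equiv> gset_class H"

lemma cls_eq_iff:
  "\<lbrakk>stable_gset G S X; stable_gset G S Y\<rbrakk>
    \<Longrightarrow> cls X = cls Y \<longleftrightarrow> (\<forall>R. subgroup R H \<longrightarrow> mark X R = mark Y R)"
  by (simp add: H.gset_class_eq_iff H.gset_iso_iff_mark stable_imp_finite)

lemma carrier_M: "carrier M = cls ` {X :: ('a, nat) gset. stable_gset G S X}"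
  by (simp add: stable_semiring_def)

lemma carrier_M_E:
  assumes "x \<in> carrier M"
  obtains X :: "('a, nat) gset" where "stable_gset G S X" "x = cls X"
  using assms by (auto simp: carrier_M)

lemma cls_in_carrier:
  assumes "stable_gset G S X"
  shows "cls X \<in> carrier M"
proof -
  obtain Y :: "('a, nat) gset" where Y: "finite_gset H Y" "gset_iso H X Y"
    using H.gset_transport_nat[OF stable_imp_finite[OF assms]] by blast
  then have "stable_gset G S Y" "cls X = cls Y"
    using stable_iso[OF assms Y] H.gset_class_eq_iff[OF stable_imp_finite[OF assms] Y(1)] by auto
  then show ?thesis by (auto simp: carrier_M)
qed

text \<open>The semiring operations are unions over pairs of representatives; this reduces such a
  union to a single class. Representatives enter only through their marks, which are what is
  computed for sums and products.\<close>

lemma Union_class_const: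
  assumes "stable_gset G S X" "stable_gset G S Y"
    and "\<And>X' Y' :: ('a, nat) gset. \<lbrakk>stable_gset G S X'; stable_gset G S Y';
           \<And>R. subgroup R H \<Longrightarrow> mark X' R = mark X R; \<And>R. subgroup R H \<Longrightarrow> mark Y' R = mark Y R\<rbrakk>
         \<Longrightarrow> f X' Y' = c"
  shows "(\<Union>X'\<in>cls X. \<Union>Y'\<in>cls Y. f X' Y') = c"
proof -
  have *: "\<exists>Z. Z \<in> cls W" "\<And>Z. Z \<in> cls W \<Longrightarrow> stable_gset G S Z \<and> (\<forall>R. subgroup R H \<longrightarrow> mark Z R = mark W R)"
    if W: "stable_gset G S W" for W :: "('a, 'w) gset"
  proof -
    show "\<exists>Z. Z \<in> cls W"
      using H.gset_transport_nat[OF stable_imp_finite[OF W]] by (auto simp: gset_class_def)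
    fix Z assume "Z \<in> cls W"
    then have Z: "finite_gset H Z" "gset_iso H W Z" by (auto simp: gset_class_def)
    then show "stable_gset G S Z \<and> (\<forall>R. subgroup R H \<longrightarrow> mark Z R = mark W R)"
      using stable_iso[OF W Z] H.gset_iso_iff_mark[OF stable_imp_finite[OF W] Z(1)] by auto
  qed
  have "f X' Y' = c" if "X' \<in> cls X" "Y' \<in> cls Y" for X' Y'
    using *(2)[OF assms(1) that(1)] *(2)[OF assms(2) that(2)] by (intro assms(3)) auto
  then show ?thesis using *(1)[OF assms(1)] *(1)[OF assms(2)] by auto
qed

lemma add_cls:
  assumes "stable_gset G S X" "stable_gset G S Y"
  shows "cls X \<oplus>\<^bsub>M\<^esub> cls Y = cls (gset_sum X Y)"
proof -
  have "(\<Union>X'\<in>cls X. \<Union>Y'\<in>cls Y. cls (gset_sum X' Y')) = cls (gset_sum X Y)"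
    using assms
    by (intro Union_class_const) (simp_all add: cls_eq_iff stable_sum mark_sum stable_imp_finite_points)
  then show ?thesis by (simp add: stable_semiring_def burnside_semiring_def)
qed

lemma mult_cls:
  assumes "stable_gset G S X" "stable_gset G S Y"
  shows "cls X \<otimes>\<^bsub>M\<^esub> cls Y = cls (gset_prod X Y)"
proof -
  have "(\<Union>X'\<in>cls X. \<Union>Y'\<in>cls Y. cls (gset_prod X' Y')) = cls (gset_prod X Y)"
    using assms
    by (intro Union_class_const) (simp_all add: cls_eq_iff stable_prod mark_prod)
  then show ?thesis by (simp add: stable_semiring_def burnside_semiring_def)
qed

lemma zero_M: "\<zero>\<^bsub>M\<^esub> = cls (empty_gset :: ('a, nat) gset)"
  by (simp add: stable_semiring_def burnside_semiring_def)

lemma one_M: "\<one>\<^bsub>M\<^esub> = cls (point_gset (0 :: nat))"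
  by (simp add: stable_semiring_def burnside_semiring_def)

lemmas M_simps = cls_eq_iff add_cls mult_cls zero_M one_M cls_in_carrier stable_sum stable_prod stable_empty
  stable_point mark_sum mark_prod mark_empty mark_point stable_imp_finite_points

text \<open>A class is determined by its marks, on which disjoint union and product act as addition
  and multiplication. The laws are therefore those of the natural numbers.\<close>

theorem semiring_M: "semiring M"
proof (intro semiring.intro abelian_monoidI monoidI semiring_axioms.intro)
  fix x y assume "x \<in> carrier M" "y \<in> carrier M"
  then obtain X Y :: "('a, nat) gset"
    where "stable_gset G S X" "x = cls X" "stable_gset G S Y" "y = cls Y"
    using carrier_M_E by metis
  note XY = this
  show "x \<oplus>\<^bsub>M\<^esub> y \<in> carrier M" "x \<otimes>\<^bsub>M\<^esub> y \<in> carrier M"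
    using XY by (simp_all add: M_simps)
  show "x \<oplus>\<^bsub>M\<^esub> y = y \<oplus>\<^bsub>M\<^esub> x"
    using XY by (simp add: M_simps)
  fix z assume "z \<in> carrier M"
  then obtain Z :: "('a, nat) gset" where "stable_gset G S Z" "z = cls Z"
    using carrier_M_E by metis
  note Z = this
  show "x \<oplus>\<^bsub>M\<^esub> y \<oplus>\<^bsub>M\<^esub> z = x \<oplus>\<^bsub>M\<^esub> (y \<oplus>\<^bsub>M\<^esub> z)"
    "x \<otimes>\<^bsub>M\<^esub> y \<otimes>\<^bsub>M\<^esub> z = x \<otimes>\<^bsub>M\<^esub> (y \<otimes>\<^bsub>M\<^esub> z)"
    "(x \<oplus>\<^bsub>M\<^esub> y) \<otimes>\<^bsub>M\<^esub> z = x \<otimes>\<^bsub>M\<^esub> z \<oplus>\<^bsub>M\<^esub> y \<otimes>\<^bsub>M\<^esub> z"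
    "z \<otimes>\<^bsub>M\<^esub> (x \<oplus>\<^bsub>M\<^esub> y) = z \<otimes>\<^bsub>M\<^esub> x \<oplus>\<^bsub>M\<^esub> z \<otimes>\<^bsub>M\<^esub> y"
    using XY Z by (simp_all add: M_simps algebra_simps)
next
  fix x assume "x \<in> carrier M"
  then obtain X :: "('a, nat) gset" where X: "stable_gset G S X" "x = cls X"
    using carrier_M_E by metis
  then show "\<zero>\<^bsub>M\<^esub> \<oplus>\<^bsub>M\<^esub> x = x" "\<one>\<^bsub>M\<^esub> \<otimes>\<^bsub>M\<^esub> x = x" "x \<otimes>\<^bsub>M\<^esub> \<one>\<^bsub>M\<^esub> = x"
    "\<zero>\<^bsub>M\<^esub> \<otimes>\<^bsub>M\<^esub> x = \<zero>\<^bsub>M\<^esub>" "x \<otimes>\<^bsub>M\<^esub> \<zero>\<^bsub>M\<^esub> = \<zero>\<^bsub>M\<^esub>"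
    by (simp_all add: M_simps)
qed (simp_all add: M_simps)

section \<open>Orbit numbers as additive coordinates on classes\<close>

definition class_orbit_number :: "('a, nat) gset set \<Rightarrow> 'a set \<Rightarrow> nat" where
  "class_orbit_number x Q = orbit_number (SOME X. X \<in> x) Q"

lemma class_orbit_number_cls:
  assumes "stable_gset G S X"
  shows "class_orbit_number (cls X) Q = orbit_number X Q"
proof -
  have "\<exists>Y. Y \<in> cls X"
    using H.gset_transport_nat[OF stable_imp_finite[OF assms]] by (auto simp: gset_class_def)
  then have "(SOME Y. Y \<in> cls X) \<in> cls X" by (rule someI_ex)
  then have "gset_iso H X (SOME Y. Y \<in> cls X)" by (simp add: gset_class_def)
  then show ?thesis
    unfolding class_orbit_number_def using orbit_number_iso[OF stable_imp_finite[OF assms]] by metis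
qed

lemma class_orbit_number_inj:
  assumes "x \<in> carrier M" "y \<in> carrier M"
    and "\<And>Q. Q \<in> reps \<Longrightarrow> class_orbit_number x Q = class_orbit_number y Q"
  shows "x = y"
proof -
  obtain X Y :: "('a, nat) gset"
    where XY: "stable_gset G S X" "x = cls X" "stable_gset G S Y" "y = cls Y"
    using assms(1,2) carrier_M_E by metis
  then have "gset_iso H X Y"
    using assms(3) by (intro stable_iso_if_orbit_numbers) (auto simp: class_orbit_number_cls)
  then show ?thesis using XY by (simp add: H.gset_class_eq_iff stable_imp_finite)
qed

lemma class_orbit_number_add:
  assumes "x \<in> carrier M" "y \<in> carrier M" "Q \<in> reps"
  shows "class_orbit_number (x \<oplus>\<^bsub>M\<^esub> y) Q = class_orbit_number x Q + class_orbit_number y Q"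
proof -
  obtain X Y :: "('a, nat) gset"
    where "stable_gset G S X" "x = cls X" "stable_gset G S Y" "y = cls Y"
    using assms(1,2) carrier_M_E by metis
  then show ?thesis
    using assms(3) by (simp add: add_cls class_orbit_number_cls stable_sum orbit_number_sum
        stable_imp_finite subgroup_reps)
qed

lemma class_orbit_number_zero: "class_orbit_number \<zero>\<^bsub>M\<^esub> Q = 0"
  by (simp add: zero_M class_orbit_number_cls stable_empty orbit_number_empty)

lemma class_orbit_number_basic:
  assumes "P \<in> reps"
  shows "class_orbit_number (basic_class Q) P = (if P = Q then 1 else 0)"
proof -
  obtain X :: "('a, nat) gset" where X: "basic X Q" using ex_basic by blast
  then have "class_orbit_number (basic_class Q) P = orbit_number X P"
    by (simp add: basic_class_eq class_orbit_number_cls basic_def)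
  then show ?thesis using X assms by (simp add: basic_def)
qed

lemma basic_class_in_carrier: "basic_class Q \<in> carrier M"
  using ex_basic[of Q] basic_class_eq cls_in_carrier by (metis basic_def)

text \<open>Orbit numbers at the representatives are additive and injective on classes and take the
  irreducible classes to the unit vectors. The coefficient of \<open>x\<close> at
  \<open>basic_class Q\<close> is thus forced to be its coordinate at \<open>Q\<close>.\<close>

lemma free_M: "free_comm_monoid_basis (add_monoid M) (irreducible_classes G S)"
proof -
  define A where "A = add_monoid M"
  have A [simp]: "carrier A = carrier M" "monoid.mult A = add M" "one A = zero M"
    by (simp_all add: A_def)
  interpret A: comm_monoid A
    using semiring_M by (simp add: semiring_def abelian_monoid_def A_def)
  let ?B = "irreducible_classes G S"
  have B: "?B = basic_class ` reps" using bij_basic_class by (simp add: bij_betw_def)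
  then have sub: "?B \<subseteq> carrier M" using basic_class_in_carrier by auto
  have finB: "finite ?B" using B finite_reps by simp
  have pow: "b [^]\<^bsub>A\<^esub> (k :: nat) \<in> carrier M \<and>
      class_orbit_number (b [^]\<^bsub>A\<^esub> k) Q = k * class_orbit_number b Q"
    if "b \<in> carrier M" "Q \<in> reps" for b k Q
  proof (induction k)
    case 0
    then show ?case using A.one_closed by (simp add: class_orbit_number_zero)
  next
    case (Suc k)
    then show ?case using that A.m_closed[of _ b] by (simp add: class_orbit_number_add)
  qed
  have prod: "class_orbit_number (\<Otimes>\<^bsub>A\<^esub>b\<in>F. b [^]\<^bsub>A\<^esub> c b) Q =
      (\<Sum>b\<in>F. c b * class_orbit_number b Q)"
    if "finite F" "F \<subseteq> carrier M" "Q \<in> reps" for F Q and c :: "('a, nat) gset set \<Rightarrow> nat"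
    using that
  proof (induction F rule: finite_induct)
    case empty
    then show ?case by (simp add: class_orbit_number_zero)
  next
    case (insert b F)
    then have "(\<Otimes>\<^bsub>A\<^esub>b\<in>insert b F. b [^]\<^bsub>A\<^esub> c b) =
        b [^]\<^bsub>A\<^esub> c b \<oplus>\<^bsub>M\<^esub> (\<Otimes>\<^bsub>A\<^esub>b\<in>F. b [^]\<^bsub>A\<^esub> c b)"
      using pow by (subst A.finprod_insert) auto
    moreover have "(\<Otimes>\<^bsub>A\<^esub>b\<in>F. b [^]\<^bsub>A\<^esub> c b) \<in> carrier A"
      using insert.prems pow by (intro A.finprod_closed) auto
    ultimately show ?case
      using insert pow by (simp add: class_orbit_number_add)
  qed
  \<comment> \<open>This settles existence and uniqueness together: being an expansion of
    \<open>x\<close> is the same as having prescribed values on all of \<open>?B\<close>.\<close>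
  have iff: "x = (\<Otimes>\<^bsub>A\<^esub>b\<in>{b \<in> ?B. c b \<noteq> 0}. b [^]\<^bsub>A\<^esub> c b) \<longleftrightarrow>
      (\<forall>Q\<in>reps. c (basic_class Q) = class_orbit_number x Q)"
    if x: "x \<in> carrier M" for x and c :: "('a, nat) gset set \<Rightarrow> nat"
  proof -
    let ?F = "{b \<in> ?B. c b \<noteq> 0}"
    let ?p = "\<Otimes>\<^bsub>A\<^esub>b\<in>?F. b [^]\<^bsub>A\<^esub> c b"
    have "?p \<in> carrier A"
      using sub A.nat_pow_closed by (intro A.finprod_closed) auto
    then have p: "?p \<in> carrier M" by simp
    have orb: "class_orbit_number ?p Q = c (basic_class Q)" if Q: "Q \<in> reps" for Q
    proof -
      have "class_orbit_number ?p Q = (\<Sum>b\<in>?F. c b * class_orbit_number b Q)"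
        by (rule prod) (use sub finB Q in auto)
      also have "\<dots> = (\<Sum>b\<in>?B. c b * class_orbit_number b Q)"
        using finB by (intro sum.mono_neutral_left) auto
      also have "\<dots> = (\<Sum>P\<in>reps. c (basic_class P) * class_orbit_number (basic_class P) Q)"
        by (rule sum.reindex_bij_betw[OF bij_basic_class, symmetric])
      also have "\<dots> = (\<Sum>P\<in>reps. if P = Q then c (basic_class Q) else 0)"
        using Q by (intro sum.cong) (auto simp: class_orbit_number_basic)
      also have "\<dots> = c (basic_class Q)" using Q finite_reps by simp
      finally show ?thesis .
    qed
    show ?thesis
    proof
      assume "x = ?p"
      then show "\<forall>Q\<in>reps. c (basic_class Q) = class_orbit_number x Q" using orb by simp
    next
      assume "\<forall>Q\<in>reps. c (basic_class Q) = class_orbit_number x Q"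
      then show "x = ?p" using orb by (intro class_orbit_number_inj[OF x p]) simp
    qed
  qed
  show ?thesis
    unfolding free_comm_monoid_basis_def A_def [symmetric]
  proof (intro conjI ballI)
    show "?B \<subseteq> carrier A" using sub by simp
    fix x assume "x \<in> carrier A"
    then have x: "x \<in> carrier M" by simp
    \<comment> \<open>The coordinates of \<open>x\<close>, carried to the irreducible classes along
      the inverse of \<open>basic_class\<close> and made extensional as the notion of basis
      demands.\<close>
    let ?c = "\<lambda>b\<in>?B. class_orbit_number x (inv_into reps basic_class b)"
    show "\<exists>!c :: _ \<Rightarrow> nat. c \<in> extensional ?B \<and> finite {b \<in> ?B. c b \<noteq> 0} \<and>
        x = (\<Otimes>\<^bsub>A\<^esub>b\<in>{b \<in> ?B. c b \<noteq> 0}. b [^]\<^bsub>A\<^esub> c b)"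
    proof (rule ex1I[of _ ?c])
      have "?c (basic_class Q) = class_orbit_number x Q" if "Q \<in> reps" for Q
        using that B bij_betw_imp_inj_on[OF bij_basic_class] by simp
      then show "?c \<in> extensional ?B \<and> finite {b \<in> ?B. ?c b \<noteq> 0} \<and>
          x = (\<Otimes>\<^bsub>A\<^esub>b\<in>{b \<in> ?B. ?c b \<noteq> 0}. b [^]\<^bsub>A\<^esub> ?c b)"
        using finB unfolding iff[OF x] by simp
      fix c :: "_ \<Rightarrow> nat" assume "c \<in> extensional ?B \<and> finite {b \<in> ?B. c b \<noteq> 0} \<and>
          x = (\<Otimes>\<^bsub>A\<^esub>b\<in>{b \<in> ?B. c b \<noteq> 0}. b [^]\<^bsub>A\<^esub> c b)"
      then have c: "c \<in> extensional ?B" "\<forall>Q\<in>reps. c (basic_class Q) = class_orbit_number x Q"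
        unfolding iff[OF x] by auto
      show "c = ?c"
      proof (rule extensionalityI[OF c(1)])
        show "?c \<in> extensional ?B" by simp
        fix b assume b: "b \<in> ?B"
        then obtain Q where "Q \<in> reps" "b = basic_class Q" using B by auto
        then show "c b = ?c b"
          using c(2) b bij_betw_imp_inj_on[OF bij_basic_class] by simp
      qed
    qed
  qed
qed

end

theorem theorem1:
  fixes G :: "('g, 'b) monoid_scheme" and S :: "'g set" and p :: nat
  assumes "group G" and "finite (carrier G)" and "prime p" and "sylow_subgroup G p S"
  shows
    "(\<forall>X :: ('g, 'x) gset. stable_gset G S X \<longrightarrow>
        (\<exists>n Y. irreducible_splitting G S X n Y) \<and>
        (\<forall>n Y m Z. irreducible_splitting G S X n Y \<and> irreducible_splitting G S X m Z \<longrightarrow>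
           (\<exists>\<sigma>. bij_betw \<sigma> {..<n} {..<m} \<and>
                (\<forall>i<n. gset_iso (G\<lparr>carrier := S\<rparr>) (Y i) (Z (\<sigma> i)))))) \<and>
     (\<exists>f. bij_betw f (irreducible_classes G S) (subgroup_conj_classes G S)) \<and>
     semiring (stable_semiring G S) \<and>
     free_comm_monoid_of_rank (add_monoid (stable_semiring G S))
       (card (subgroup_conj_classes G S))"
proof -
  interpret sylow_pair G S p
    using assms unfolding sylow_pair_def sylow_pair_axioms_def fin_group_pair_def fin_group_def
      fin_group_axioms_def sylow_subgroup_def by blast
  \<comment> \<open>An irreducible class goes to the representative that is its type; followed by
    \<open>bij_reps_classes\<close>, this is the correspondence with conjugacy classes.\<close>
  have bij: "bij_betw (inv_into reps basic_class) (irreducible_classes G S) reps"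
    by (rule bij_betw_inv_into[OF bij_basic_class])
  have "free_comm_monoid_of_rank (add_monoid M) (card (subgroup_conj_classes G S))"
    unfolding free_comm_monoid_of_rank_def
  proof (intro conjI exI)
    show "comm_monoid (add_monoid M)"
      using semiring_M by (simp add: semiring_def abelian_monoid_def)
    show "finite (irreducible_classes G S)" "card (irreducible_classes G S) = card (subgroup_conj_classes G S)"
      using bij_betw_finite[OF bij] bij_betw_same_card[OF bij] finite_reps card_reps by auto
  qed (rule free_M)
  moreover have "\<exists>f. bij_betw f (irreducible_classes G S) (subgroup_conj_classes G S)"
    using bij_betw_trans[OF bij bij_reps_classes] by blast
  ultimately show ?thesis
    using ex_irreducible_splitting irreducible_splitting_unique semiring_M by blast
qed

end
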